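(* Let $A$ be a real vector bundle over a smooth manifold $M$, and let $A_{\mathbb{C}}=A\otimes\mathbb{C}$ be its complexification. Then for any complex Lie algebroid structure $([\cdot,\cdot],\rho)$ on $A_{\mathbb{C}}$ there exists a complex matched pair of skew-algebroid structures $(A,[\cdot,\cdot]_1,\rho_1)$, $(A,[\cdot,\cdot]_2,\rho_2)$ on $A$ whose complex sum is $(A_{\mathbb{C}},[\cdot,\cdot],\rho)$.
   Context: A (real) skew-algebroid on a real vector bundle $A\to M$ is a triple $(A,[\cdot,\cdot],\rho)$ with $[\cdot,\cdot]$ an $\mathbb{R}$-bilinear skew-symmetric bracket on $\Gamma(A)$ and $\rho:A\to TM$ a bundle map such that $[\alpha,f\beta]=f[\alpha,\beta]+(\rho(\alpha)f)\beta$ for $f\in C^\infty(M)$ (the Jacobi identity is not required). A complex Lie algebroid is a complex vector bundle $E\to M$ with a $\mathbb{C}$-bilinear Lie bracket on $\Gamma(E)$ (satisfying Jacobi) and a $\mathbb{C}$-linear bundle map $\rho:E\to T_{\mathbb{C}}M=TM\otimes\mathbb{C}$ preserving brackets and satisfying the Leibniz identity for all $f\in C^\infty(M,\mathbb{C})$. The complex sum of two skew-algebroid structures $(A,[\cdot,\cdot]_1,\rho_1)$ and $(A,[\cdot,\cdot]_2,\rho_2)$ is the bundle $A_{\mathbb{C}}$ with bracket $[a,b]=[a,b]_1+i[a,b]_2$ for $a,b\in\Gamma(A)$, extended $\mathbb{C}$-bilinearly to $\Gamma(A_{\mathbb{C}})$, and anchor $\rho(a+ib)=\rho_1(a)-\rho_2(b)+i(\rho_1(b)+\rho_2(a))$.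 The pair is a complex matched pair if: (i) the brackets commute, i.e. $([a,[b,c]_1]_2+\text{cyclic perm.})+([a,[b,c]_2]_1+\text{cyclic perm.})=0$ for all $a,b,c\in\Gamma(A)$; and (ii) the Jacobiators agree, $\mathrm{Jac}[\cdot,\cdot]_1=\mathrm{Jac}[\cdot,\cdot]_2$, where $\mathrm{Jac}[\cdot,\cdot](a,b,c)=[a,[b,c]]+\text{cyclic perm.}$ *)

theory Defs
  imports "HOL-Analysis.Analysis" "HOL-Algebra.Module" "HOL-Algebra.Algebraic_Closure_Type"
begin

(* Smooth manifolds.  A chart is a pair of its domain and its coordinate map into the
   topological space Euclidean_space n, whose points are the functions x :: nat => real with
   x i = 0 for i >= n; this keeps the dimension an arbitrary natural number (0 included). *)

text \<open>\<open>Ck_on n k U f\<close>, for \<open>U\<close> open in \<open>Euclidean_space n\<close>: all iterated partial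
  derivatives of \<open>f\<close> of order at most \<open>k\<close> exist and are continuous on \<open>U\<close>.\<close>

primrec Ck_on ::
  "nat \<Rightarrow> nat \<Rightarrow> (nat \<Rightarrow> real) set \<Rightarrow> ((nat \<Rightarrow> real) \<Rightarrow> 'k::real_normed_vector) \<Rightarrow> bool" where
  "Ck_on n 0 U f \<longleftrightarrow> continuous_map (subtopology (Euclidean_space n) U) euclidean f"
| "Ck_on n (Suc k) U f \<longleftrightarrow>
     continuous_map (subtopology (Euclidean_space n) U) euclidean f \<and>
     (\<forall>i<n. \<exists>g. (\<forall>x\<in>U. ((\<lambda>t. f (x(i := t))) has_vector_derivative g x) (at (x i))) \<and>
                Ck_on n k U g)"

definition Cinf_on ::
  "nat \<Rightarrow> (nat \<Rightarrow> real) set \<Rightarrow> ((nat \<Rightarrow> real) \<Rightarrow> 'k::real_normed_vector) \<Rightarrow> bool" where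
  "Cinf_on n U f \<longleftrightarrow> (\<forall>k. Ck_on n k U f)"

record 'm mfd =
  mtop :: "'m topology"
  mdim :: nat
  atlas :: "('m set \<times> ('m \<Rightarrow> nat \<Rightarrow> real)) set"

abbreviation points :: "'m mfd \<Rightarrow> 'm set" where
  "points M \<equiv> topspace (mtop M)"

definition smooth_manifold :: "'m mfd \<Rightarrow> bool" where
  "smooth_manifold M \<longleftrightarrow>
     Hausdorff_space (mtop M) \<and> second_countable (mtop M) \<and>
     (\<Union>(U, \<phi>)\<in>atlas M. U) = points M \<and>
     (\<forall>(U, \<phi>)\<in>atlas M.
        openin (mtop M) U \<and> openin (Euclidean_space (mdim M)) (\<phi> ` U) \<and>
        homeomorphic_map (subtopology (mtop M) U)
          (subtopology (Euclidean_space (mdim M)) (\<phi> ` U)) \<phi>) \<and>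
     (\<forall>(U, \<phi>)\<in>atlas M. \<forall>(V, \<psi>)\<in>atlas M. \<forall>i<mdim M.
        Cinf_on (mdim M) (\<phi> ` (U \<inter> V)) (\<lambda>y. \<psi> (inv_into U \<phi> y) i))"

text \<open>Smoothness on an open set \<open>W\<close> of a real- or complex-valued function; the values of
  \<open>f\<close> outside \<open>W\<close> are irrelevant.\<close>

definition smooth_fun_on :: "'m mfd \<Rightarrow> 'm set \<Rightarrow> ('m \<Rightarrow> 'k::real_normed_vector) \<Rightarrow> bool" where
  "smooth_fun_on M W f \<longleftrightarrow>
     (\<forall>(U, \<phi>)\<in>atlas M. Cinf_on (mdim M) (\<phi> ` (U \<inter> W)) (\<lambda>y. f (inv_into U \<phi> y)))"

(* Vector bundles over the field 'k (used for 'k = real and 'k = complex).  The fibres are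
   vector spaces in the sense of HOL-Algebra (the ring fields mult and one of the module record
   are not used), the total space is their disjoint union, and the smooth structure is given by
   local trivializations: a pair (U, Phi) such that each Phi x, for x in U, is a linear
   isomorphism from the fibre at x onto 'k^r, with smooth transition matrices. *)

type_synonym ('k, 'm, 'v) triv = "'m set \<times> ('m \<Rightarrow> 'v \<Rightarrow> nat \<Rightarrow> 'k)"

record ('k, 'm, 'v) vbundle =
  fibre :: "'m \<Rightarrow> ('k, 'v) module"
  vrank :: nat
  trivs :: "('k, 'm, 'v) triv set"

definition linear_on :: "('k, 'v) module \<Rightarrow> ('k, 'w) module \<Rightarrow> ('v \<Rightarrow> 'w) \<Rightarrow> bool" where
  "linear_on V W h \<longleftrightarrow>
     h \<in> carrier V \<rightarrow> carrier W \<and>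
     (\<forall>u\<in>carrier V. \<forall>v\<in>carrier V. h (u \<oplus>\<^bsub>V\<^esub> v) = h u \<oplus>\<^bsub>W\<^esub> h v) \<and>
     (\<forall>c. \<forall>v\<in>carrier V. h (c \<odot>\<^bsub>V\<^esub> v) = c \<odot>\<^bsub>W\<^esub> h v)"

definition coord_space :: "nat \<Rightarrow> ('k::field, nat \<Rightarrow> 'k) module" where
  "coord_space r =
     \<lparr>carrier = {c. \<forall>i\<ge>r. c i = 0}, monoid.mult = undefined, one = undefined,
      zero = (\<lambda>i. 0), add = (\<lambda>c d i. c i + d i), smult = (\<lambda>a c i. a * c i)\<rparr>"

text \<open>With respect to two trivializations the fibrewise map \<open>h\<close> is given over the
  common domain by a smooth matrix.\<close>

definition smooth_matrix_rep ::
  "'m mfd \<Rightarrow> ('k::real_normed_field, 'm, 'v) vbundle \<Rightarrow> ('k, 'm, 'w) vbundle \<Rightarrow>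
   ('k, 'm, 'v) triv \<Rightarrow> ('k, 'm, 'w) triv \<Rightarrow> ('m \<Rightarrow> 'v \<Rightarrow> 'w) \<Rightarrow> bool" where
  "smooth_matrix_rep M E F = (\<lambda>(U, \<Phi>) (V, \<Psi>) h.
     \<exists>G. (\<forall>i<vrank F. \<forall>j<vrank E. smooth_fun_on M (U \<inter> V) (\<lambda>x. G x i j)) \<and>
         (\<forall>x\<in>U \<inter> V. \<forall>v\<in>carrier (fibre E x). \<forall>i<vrank F.
            \<Psi> x (h x v) i = (\<Sum>j<vrank E. G x i j * \<Phi> x v j)))"

definition vector_bundle :: "'m mfd \<Rightarrow> ('k::real_normed_field, 'm, 'v) vbundle \<Rightarrow> bool" where
  "vector_bundle M E \<longleftrightarrow>
     smooth_manifold M \<and>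
     (\<forall>x\<in>points M. Module.module (ring_of_type_algebra :: 'k ring) (fibre E x)) \<and>
     (\<Union>(U, \<Phi>)\<in>trivs E. U) = points M \<and>
     (\<forall>(U, \<Phi>)\<in>trivs E.
        openin (mtop M) U \<and>
        (\<forall>x\<in>U. linear_on (fibre E x) (coord_space (vrank E)) (\<Phi> x) \<and>
               bij_betw (\<Phi> x) (carrier (fibre E x)) (carrier (coord_space (vrank E))))) \<and>
     (\<forall>S\<in>trivs E. \<forall>T\<in>trivs E. smooth_matrix_rep M E E S T (\<lambda>x v. v))"

text \<open>Vector bundle morphisms over the identity of the base.\<close>

definition bundle_map ::
  "'m mfd \<Rightarrow> ('k::real_normed_field, 'm, 'v) vbundle \<Rightarrow> ('k, 'm, 'w) vbundle \<Rightarrow>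
   ('m \<Rightarrow> 'v \<Rightarrow> 'w) \<Rightarrow> bool" where
  "bundle_map M E F h \<longleftrightarrow>
     (\<forall>x\<in>points M. linear_on (fibre E x) (fibre F x) (h x)) \<and>
     (\<forall>S\<in>trivs E. \<forall>T\<in>trivs F. smooth_matrix_rep M E F S T h)"

text \<open>The \<open>'k\<close>-vector space of smooth global sections.  Sections are extensional,
  so that equality of sections is equality of functions.\<close>

definition sections ::
  "'m mfd \<Rightarrow> ('k::real_normed_field, 'm, 'v) vbundle \<Rightarrow> ('k, 'm \<Rightarrow> 'v) module" where
  "sections M E =
     \<lparr>carrier = {s \<in> (\<Pi>\<^sub>E x\<in>points M. carrier (fibre E x)).
                  \<forall>(U, \<Phi>)\<in>trivs E. \<forall>i<vrank E. smooth_fun_on M U (\<lambda>x. \<Phi> x (s x) i)},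
      monoid.mult = undefined, one = undefined,
      zero = (\<lambda>x\<in>points M. \<zero>\<^bsub>fibre E x\<^esub>),
      add = (\<lambda>s t. \<lambda>x\<in>points M. s x \<oplus>\<^bsub>fibre E x\<^esub> t x),
      smult = (\<lambda>c s. \<lambda>x\<in>points M. c \<odot>\<^bsub>fibre E x\<^esub> s x)\<rparr>"

definition fun_smult ::
  "'m mfd \<Rightarrow> ('k, 'm, 'v) vbundle \<Rightarrow> ('m \<Rightarrow> 'k) \<Rightarrow> ('m \<Rightarrow> 'v) \<Rightarrow> 'm \<Rightarrow> 'v" where
  "fun_smult M E f s = (\<lambda>x\<in>points M. f x \<odot>\<^bsub>fibre E x\<^esub> s x)"

text \<open>Tangent vectors at \<open>p\<close> are the derivations at \<open>p\<close> of the functions that are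
  smooth near \<open>p\<close>.  They are extensional on the set of these functions.  By the Leibniz
  rule a derivation depends only on the germ of its argument.  In a chart, the components of a
  tangent vector are its values on the coordinate functions.\<close>

definition smooth_near :: "'m mfd \<Rightarrow> 'm \<Rightarrow> ('m \<Rightarrow> real) set" where
  "smooth_near M p = {f. \<exists>W. openin (mtop M) W \<and> p \<in> W \<and> smooth_fun_on M W f}"

definition tangent_space :: "'m mfd \<Rightarrow> 'm \<Rightarrow> (real, ('m \<Rightarrow> real) \<Rightarrow> real) module" where
  "tangent_space M p =
     \<lparr>carrier = {v \<in> extensional (smooth_near M p).
        (\<forall>f\<in>smooth_near M p. \<forall>g\<in>smooth_near M p. v (\<lambda>q. f q + g q) = v f + v g) \<and>
        (\<forall>c. \<forall>f\<in>smooth_near M p. v (\<lambda>q. c * f q) = c * v f) \<and>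
        (\<forall>f\<in>smooth_near M p. \<forall>g\<in>smooth_near M p.
           v (\<lambda>q. f q * g q) = f p * v g + g p * v f)},
      monoid.mult = undefined, one = undefined,
      zero = (\<lambda>f\<in>smooth_near M p. 0),
      add = (\<lambda>v w. \<lambda>f\<in>smooth_near M p. v f + w f),
      smult = (\<lambda>c v. \<lambda>f\<in>smooth_near M p. c * v f)\<rparr>"

definition tangent_bundle :: "'m mfd \<Rightarrow> (real, 'm, ('m \<Rightarrow> real) \<Rightarrow> real) vbundle" where
  "tangent_bundle M =
     \<lparr>fibre = tangent_space M,
      vrank = mdim M,
      trivs = (\<lambda>(U, \<phi>). (U, \<lambda>p v i. if i < mdim M then v (\<lambda>q. \<phi> q i) else 0)) ` atlas M\<rparr>"

text \<open>The pair \<open>(a, b)\<close> stands for \<open>a + \<i>b = a \<otimes> 1 + b \<otimes> \<i>\<close>.\<close>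

definition complexify_space :: "(real, 'v) module \<Rightarrow> (complex, 'v \<times> 'v) module" where
  "complexify_space V =
     \<lparr>carrier = carrier V \<times> carrier V, monoid.mult = undefined, one = undefined,
      zero = (\<zero>\<^bsub>V\<^esub>, \<zero>\<^bsub>V\<^esub>),
      add = (\<lambda>(a, b) (a', b'). (a \<oplus>\<^bsub>V\<^esub> a', b \<oplus>\<^bsub>V\<^esub> b')),
      smult = (\<lambda>c (a, b). ((Re c \<odot>\<^bsub>V\<^esub> a) \<ominus>\<^bsub>V\<^esub> (Im c \<odot>\<^bsub>V\<^esub> b),
                           (Re c \<odot>\<^bsub>V\<^esub> b) \<oplus>\<^bsub>V\<^esub> (Im c \<odot>\<^bsub>V\<^esub> a)))\<rparr>"

definition complexification :: "(real, 'm, 'v) vbundle \<Rightarrow> (complex, 'm, 'v \<times> 'v) vbundle" where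
  "complexification A =
     \<lparr>fibre = (\<lambda>x. complexify_space (fibre A x)),
      vrank = vrank A,
      trivs = (\<lambda>(U, \<Phi>). (U, \<lambda>x (a, b) i. Complex (\<Phi> x a i) (\<Phi> x b i))) ` trivs A\<rparr>"

text \<open>The action of a complex tangent vector \<open>u + \<i>w\<close> on a complex-valued function,
  extending that of real tangent vectors complex-bilinearly.\<close>

definition cderiv ::
  "(('m \<Rightarrow> real) \<Rightarrow> real) \<times> (('m \<Rightarrow> real) \<Rightarrow> real) \<Rightarrow> ('m \<Rightarrow> complex) \<Rightarrow> complex" where
  "cderiv = (\<lambda>(u, w) f.
     Complex (u (\<lambda>q. Re (f q)) - w (\<lambda>q. Im (f q))) (u (\<lambda>q. Im (f q)) + w (\<lambda>q. Re (f q))))"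

definition skew_bilinear :: "('k, 's) module \<Rightarrow> ('s \<Rightarrow> 's \<Rightarrow> 's) \<Rightarrow> bool" where
  "skew_bilinear V br \<longleftrightarrow>
     (\<forall>a\<in>carrier V. linear_on V V (br a) \<and> linear_on V V (\<lambda>b. br b a)) \<and>
     (\<forall>a\<in>carrier V. \<forall>b\<in>carrier V. br a b = \<ominus>\<^bsub>V\<^esub> br b a)"

text \<open>\<open>cyclic_sum V br br' a b c\<close> is
  \<open>[a, [b, c]'] + [b, [c, a]'] + [c, [a, b]']\<close>.\<close>

definition cyclic_sum ::
  "('k, 's) module \<Rightarrow> ('s \<Rightarrow> 's \<Rightarrow> 's) \<Rightarrow> ('s \<Rightarrow> 's \<Rightarrow> 's) \<Rightarrow> 's \<Rightarrow> 's \<Rightarrow> 's \<Rightarrow> 's" where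
  "cyclic_sum V br br' a b c = br a (br' b c) \<oplus>\<^bsub>V\<^esub> br b (br' c a) \<oplus>\<^bsub>V\<^esub> br c (br' a b)"

abbreviation jacobiator ::
  "('k, 's) module \<Rightarrow> ('s \<Rightarrow> 's \<Rightarrow> 's) \<Rightarrow> 's \<Rightarrow> 's \<Rightarrow> 's \<Rightarrow> 's" where
  "jacobiator V br \<equiv> cyclic_sum V br br"

definition skew_algebroid ::
  "'m mfd \<Rightarrow> (real, 'm, 'v) vbundle \<Rightarrow> (('m \<Rightarrow> 'v) \<Rightarrow> ('m \<Rightarrow> 'v) \<Rightarrow> ('m \<Rightarrow> 'v)) \<Rightarrow>
   ('m \<Rightarrow> 'v \<Rightarrow> ('m \<Rightarrow> real) \<Rightarrow> real) \<Rightarrow> bool" where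
  "skew_algebroid M A br \<rho> \<longleftrightarrow>
     vector_bundle M A \<and>
     skew_bilinear (sections M A) br \<and>
     bundle_map M A (tangent_bundle M) \<rho> \<and>
     (\<forall>\<alpha>\<in>carrier (sections M A). \<forall>\<beta>\<in>carrier (sections M A).
        \<forall>f. smooth_fun_on M (points M) f \<longrightarrow>
          br \<alpha> (fun_smult M A f \<beta>) =
            fun_smult M A f (br \<alpha> \<beta>)
            \<oplus>\<^bsub>sections M A\<^esub> fun_smult M A (\<lambda>x. \<rho> x (\<alpha> x) f) \<beta>)"

definition complex_Lie_algebroid ::
  "'m mfd \<Rightarrow> (complex, 'm, 'v) vbundle \<Rightarrow> (('m \<Rightarrow> 'v) \<Rightarrow> ('m \<Rightarrow> 'v) \<Rightarrow> ('m \<Rightarrow> 'v)) \<Rightarrow>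
   ('m \<Rightarrow> 'v \<Rightarrow> (('m \<Rightarrow> real) \<Rightarrow> real) \<times> (('m \<Rightarrow> real) \<Rightarrow> real)) \<Rightarrow> bool" where
  "complex_Lie_algebroid M E br \<rho> \<longleftrightarrow>
     vector_bundle M E \<and>
     skew_bilinear (sections M E) br \<and>
     (\<forall>\<alpha>\<in>carrier (sections M E). \<forall>\<beta>\<in>carrier (sections M E). \<forall>\<gamma>\<in>carrier (sections M E).
        jacobiator (sections M E) br \<alpha> \<beta> \<gamma> = \<zero>\<^bsub>sections M E\<^esub>) \<and>
     bundle_map M E (complexification (tangent_bundle M)) \<rho> \<and>
     (\<forall>\<alpha>\<in>carrier (sections M E). \<forall>\<beta>\<in>carrier (sections M E).
        \<forall>f. smooth_fun_on M (points M) f \<longrightarrow>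
          (\<forall>x\<in>points M. cderiv (\<rho> x (br \<alpha> \<beta> x)) f =
             cderiv (\<rho> x (\<alpha> x)) (\<lambda>y. cderiv (\<rho> y (\<beta> y)) f) -
             cderiv (\<rho> x (\<beta> x)) (\<lambda>y. cderiv (\<rho> y (\<alpha> y)) f))) \<and>
     (\<forall>\<alpha>\<in>carrier (sections M E). \<forall>\<beta>\<in>carrier (sections M E).
        \<forall>f. smooth_fun_on M (points M) f \<longrightarrow>
          br \<alpha> (fun_smult M E f \<beta>) =
            fun_smult M E f (br \<alpha> \<beta>)
            \<oplus>\<^bsub>sections M E\<^esub> fun_smult M E (\<lambda>x. cderiv (\<rho> x (\<alpha> x)) f) \<beta>)"

definition complex_matched_pair ::
  "'m mfd \<Rightarrow> (real, 'm, 'v) vbundle \<Rightarrow>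
   (('m \<Rightarrow> 'v) \<Rightarrow> ('m \<Rightarrow> 'v) \<Rightarrow> ('m \<Rightarrow> 'v)) \<Rightarrow> ('m \<Rightarrow> 'v \<Rightarrow> ('m \<Rightarrow> real) \<Rightarrow> real) \<Rightarrow>
   (('m \<Rightarrow> 'v) \<Rightarrow> ('m \<Rightarrow> 'v) \<Rightarrow> ('m \<Rightarrow> 'v)) \<Rightarrow> ('m \<Rightarrow> 'v \<Rightarrow> ('m \<Rightarrow> real) \<Rightarrow> real) \<Rightarrow> bool" where
  "complex_matched_pair M A br1 \<rho>1 br2 \<rho>2 \<longleftrightarrow>
     skew_algebroid M A br1 \<rho>1 \<and> skew_algebroid M A br2 \<rho>2 \<and>
     (\<forall>a\<in>carrier (sections M A). \<forall>b\<in>carrier (sections M A). \<forall>c\<in>carrier (sections M A).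
        cyclic_sum (sections M A) br2 br1 a b c \<oplus>\<^bsub>sections M A\<^esub>
        cyclic_sum (sections M A) br1 br2 a b c = \<zero>\<^bsub>sections M A\<^esub>) \<and>
     (\<forall>a\<in>carrier (sections M A). \<forall>b\<in>carrier (sections M A). \<forall>c\<in>carrier (sections M A).
        jacobiator (sections M A) br1 a b c = jacobiator (sections M A) br2 a b c)"

text \<open>The complex-bilinear extension of \<open>(a, b) \<mapsto> [a, b]\<^sub>1 + \<i>[a, b]\<^sub>2\<close>.  A section
  of the complexification is decomposed as \<open>\<alpha> = a + \<i>b\<close> with \<open>a\<close>, \<open>b\<close> sections of
  \<open>A\<close>.\<close>

definition section_pair :: "'m mfd \<Rightarrow> ('m \<Rightarrow> 'v) \<Rightarrow> ('m \<Rightarrow> 'v) \<Rightarrow> 'm \<Rightarrow> 'v \<times> 'v" where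
  "section_pair M a b = (\<lambda>x\<in>points M. (a x, b x))"

definition section_Re :: "'m mfd \<Rightarrow> ('m \<Rightarrow> 'v \<times> 'v) \<Rightarrow> 'm \<Rightarrow> 'v" where
  "section_Re M \<alpha> = (\<lambda>x\<in>points M. fst (\<alpha> x))"

definition section_Im :: "'m mfd \<Rightarrow> ('m \<Rightarrow> 'v \<times> 'v) \<Rightarrow> 'm \<Rightarrow> 'v" where
  "section_Im M \<alpha> = (\<lambda>x\<in>points M. snd (\<alpha> x))"

definition complex_sum_bracket ::
  "'m mfd \<Rightarrow> (real, 'm, 'v) vbundle \<Rightarrow>
   (('m \<Rightarrow> 'v) \<Rightarrow> ('m \<Rightarrow> 'v) \<Rightarrow> ('m \<Rightarrow> 'v)) \<Rightarrow> (('m \<Rightarrow> 'v) \<Rightarrow> ('m \<Rightarrow> 'v) \<Rightarrow> ('m \<Rightarrow> 'v)) \<Rightarrow>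
   ('m \<Rightarrow> 'v \<times> 'v) \<Rightarrow> ('m \<Rightarrow> 'v \<times> 'v) \<Rightarrow> 'm \<Rightarrow> 'v \<times> 'v" where
  "complex_sum_bracket M A br1 br2 \<alpha> \<beta> =
     (let \<Gamma> = sections M (complexification A);
          br = (\<lambda>a b. section_pair M (br1 a b) (br2 a b));
          a = section_Re M \<alpha>; b = section_Im M \<alpha>;
          c = section_Re M \<beta>; d = section_Im M \<beta>
      in (br a c \<ominus>\<^bsub>\<Gamma>\<^esub> br b d) \<oplus>\<^bsub>\<Gamma>\<^esub> \<i> \<odot>\<^bsub>\<Gamma>\<^esub> (br a d \<oplus>\<^bsub>\<Gamma>\<^esub> br b c))"

definition complex_sum_anchor ::
  "'m mfd \<Rightarrow> ('m \<Rightarrow> 'v \<Rightarrow> ('m \<Rightarrow> real) \<Rightarrow> real) \<Rightarrow> ('m \<Rightarrow> 'v \<Rightarrow> ('m \<Rightarrow> real) \<Rightarrow> real) \<Rightarrow>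
   'm \<Rightarrow> 'v \<times> 'v \<Rightarrow> (('m \<Rightarrow> real) \<Rightarrow> real) \<times> (('m \<Rightarrow> real) \<Rightarrow> real)" where
  "complex_sum_anchor M \<rho>1 \<rho>2 x = (\<lambda>(a, b).
     (\<rho>1 x a \<ominus>\<^bsub>tangent_space M x\<^esub> \<rho>2 x b, \<rho>1 x b \<oplus>\<^bsub>tangent_space M x\<^esub> \<rho>2 x a))"

text \<open>Brackets and anchors are determined by, and compared on, sections and fibres.\<close>

definition is_complex_sum ::
  "'m mfd \<Rightarrow> (real, 'm, 'v) vbundle \<Rightarrow>
   (('m \<Rightarrow> 'v) \<Rightarrow> ('m \<Rightarrow> 'v) \<Rightarrow> ('m \<Rightarrow> 'v)) \<Rightarrow> ('m \<Rightarrow> 'v \<Rightarrow> ('m \<Rightarrow> real) \<Rightarrow> real) \<Rightarrow>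
   (('m \<Rightarrow> 'v) \<Rightarrow> ('m \<Rightarrow> 'v) \<Rightarrow> ('m \<Rightarrow> 'v)) \<Rightarrow> ('m \<Rightarrow> 'v \<Rightarrow> ('m \<Rightarrow> real) \<Rightarrow> real) \<Rightarrow>
   (('m \<Rightarrow> 'v \<times> 'v) \<Rightarrow> ('m \<Rightarrow> 'v \<times> 'v) \<Rightarrow> ('m \<Rightarrow> 'v \<times> 'v)) \<Rightarrow>
   ('m \<Rightarrow> 'v \<times> 'v \<Rightarrow> (('m \<Rightarrow> real) \<Rightarrow> real) \<times> (('m \<Rightarrow> real) \<Rightarrow> real)) \<Rightarrow> bool" where
  "is_complex_sum M A br1 \<rho>1 br2 \<rho>2 br \<rho> \<longleftrightarrow>
     (\<forall>\<alpha>\<in>carrier (sections M (complexification A)).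
        \<forall>\<beta>\<in>carrier (sections M (complexification A)).
          br \<alpha> \<beta> = complex_sum_bracket M A br1 br2 \<alpha> \<beta>) \<and>
     (\<forall>x\<in>points M. \<forall>v\<in>carrier (fibre (complexification A) x).
        \<rho> x v = complex_sum_anchor M \<rho>1 \<rho>2 x v)"

end

theory Submission
  imports Defs
begin

text \<open>
  A complex-bilinear operation on the complexification of a real vector space \<open>V\<close> is the same thing
  as its restriction to real vectors, and such a restriction is a pair of real-bilinear operations
  on \<open>V\<close>.  Applied to \<open>V = \<Gamma>(A)\<close>, this determines the two brackets: for real sections \<open>a\<close>, \<open>b\<close>
  let \<open>[a, b]\<^sub>1\<close> and \<open>[a, b]\<^sub>2\<close> be the real and imaginary parts of \<open>[a, b]\<close>, and likewise let \<open>\<rho>\<^sub>1 a\<close>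
  and \<open>\<rho>\<^sub>2 a\<close> be the parts of \<open>\<rho> a\<close>.  That the given structure is the complex sum of the two
  expresses only that it is complex-linear (\<open>bracket_eq_complex_sum\<close>, \<open>linear_on_complexify_eq\<close>).

  Both structures are skew-algebroids because each axiom of a skew-algebroid is the real or the
  imaginary part of an axiom of a complex Lie algebroid, taken on real sections and real functions
  (\<open>skew_algebroid_re_part\<close>, \<open>skew_algebroid_im_part\<close>).  The Jacobi identity separates too, but
  the nested bracket mixes the two parts: the real part equates the two Jacobiators, and the
  imaginary part is the commutation of the brackets (\<open>jacobiator_real_vectors\<close>).

  The complex-linearity and the Jacobi identity are treated as pure linear algebra over
  \<open>complexify_space V\<close> for any real vector space \<open>V\<close>.  Geometry enters through the
  isomorphism of \<open>\<Gamma>(A\<^sub>\<complex>)\<close> with \<open>complexify_space\<close> of \<open>\<Gamma>(A)\<close> (\<open>linear_on_merge_section\<close>,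
  \<open>linear_on_split_section\<close>) and the smoothness of the two anchors (\<open>bundle_map_re_part\<close>,
  \<open>bundle_map_im_part\<close>).  Both rest on the fact that a complex function is smooth if and only if its
  real and imaginary parts are.
\<close>

section \<open>Functions with continuous partial derivatives\<close>

lemma continuous_map_add_euclidean:
  fixes f g :: "'a \<Rightarrow> 'k::real_normed_vector"
  assumes "continuous_map T euclidean f" "continuous_map T euclidean g"
  shows "continuous_map T euclidean (\<lambda>x. f x + g x)"
  using assms by (auto simp: continuous_map_atin intro: tendsto_add)

lemma continuous_map_mult_euclidean:
  fixes f g :: "'a \<Rightarrow> 'k::real_normed_algebra"
  assumes "continuous_map T euclidean f" "continuous_map T euclidean g"
  shows "continuous_map T euclidean (\<lambda>x. f x * g x)"
  using assms by (auto simp: continuous_map_atin intro: tendsto_mult)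

lemma continuous_map_bounded_linear:
  assumes "bounded_linear L" "continuous_map T euclidean f"
  shows "continuous_map T euclidean (\<lambda>x. L (f x))"
  using assms by (auto simp: continuous_map_atin intro: bounded_linear.tendsto)

lemma Ck_on_SucE:
  assumes "Ck_on n (Suc k) U f" "i < n"
  obtains g where "\<And>x. x \<in> U \<Longrightarrow> ((\<lambda>t. f (x(i := t))) has_vector_derivative g x) (at (x i))"
    and "Ck_on n k U g"
  using assms unfolding Ck_on.simps by blast

lemma Ck_on_subset: "Ck_on n k U f \<Longrightarrow> V \<subseteq> U \<Longrightarrow> Ck_on n k V f"
proof (induction k arbitrary: f)
  case 0
  then show ?case by (auto intro: continuous_map_from_subtopology_mono)
next
  case (Suc k)
  have "\<exists>g. (\<forall>x\<in>V. ((\<lambda>t. f (x(i := t))) has_vector_derivative g x) (at (x i))) \<and> Ck_on n k V g"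
    if "i < n" for i
  proof -
    from that Suc.prems(1) obtain g
      where "\<forall>x\<in>U. ((\<lambda>t. f (x(i := t))) has_vector_derivative g x) (at (x i))" "Ck_on n k U g"
      by auto
    with Suc.IH Suc.prems(2) show ?thesis by (intro exI[of _ g]) blast
  qed
  moreover have "continuous_map (subtopology (Euclidean_space n) V) euclidean f"
    using Suc.prems by (auto intro: continuous_map_from_subtopology_mono)
  ultimately show ?case by simp
qed

text \<open>Products need this: the derivative \<open>f g' + f' g\<close> multiplies a derivative by an
  undifferentiated factor, which has to be taken at the lower order.\<close>

lemma Ck_on_SucD: "Ck_on n (Suc k) U f \<Longrightarrow> Ck_on n k U f"
proof (induction k arbitrary: f)
  case (Suc k)
  have "\<exists>g. (\<forall>x\<in>U. ((\<lambda>t. f (x(i := t))) has_vector_derivative g x) (at (x i))) \<and> Ck_on n k U g"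
    if "i < n" for i
  proof -
    from that Suc.prems obtain g
      where "\<forall>x\<in>U. ((\<lambda>t. f (x(i := t))) has_vector_derivative g x) (at (x i))" "Ck_on n (Suc k) U g"
      unfolding Ck_on.simps(2)[of n "Suc k"] by blast
    with Suc.IH show ?thesis by blast
  qed
  moreover have "continuous_map (subtopology (Euclidean_space n) U) euclidean f"
    using Suc.prems by simp
  ultimately show ?case unfolding Ck_on.simps(2)[of n k] by blast
qed simp

lemma Ck_on_const:
  fixes c :: "'k::real_normed_vector"
  shows "Ck_on n k U (\<lambda>x. c)"
proof (induction k arbitrary: c)
  case (Suc k)
  have "Ck_on n k U (\<lambda>x. 0 :: 'k)" by (rule Suc)
  then show ?case by (auto intro!: exI[of _ "\<lambda>x. 0"])
qed simp

lemma Ck_on_bounded_linear: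
  assumes L: "bounded_linear L"
  shows "Ck_on n k U f \<Longrightarrow> Ck_on n k U (\<lambda>x. L (f x))"
proof (induction k arbitrary: f)
  case 0
  then show ?case using L by (simp add: continuous_map_bounded_linear)
next
  case (Suc k)
  show ?case unfolding Ck_on.simps
  proof (intro conjI allI impI)
    show "continuous_map (subtopology (Euclidean_space n) U) euclidean (\<lambda>x. L (f x))"
      using Suc.prems L by (simp add: continuous_map_bounded_linear)
    fix i assume "i < n"
    then obtain g where "\<forall>x\<in>U. ((\<lambda>t. f (x(i := t))) has_vector_derivative g x) (at (x i))"
      and "Ck_on n k U g" using Suc.prems by auto
    then show "\<exists>g. (\<forall>x\<in>U. ((\<lambda>t. L (f (x(i := t)))) has_vector_derivative g x) (at (x i))) \<and>
        Ck_on n k U g"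
      using Suc.IH by (auto intro!: exI[of _ "\<lambda>x. L (g x)"] bounded_linear.has_vector_derivative[OF L])
  qed
qed

lemma Ck_on_add: "Ck_on n k U f \<Longrightarrow> Ck_on n k U g \<Longrightarrow> Ck_on n k U (\<lambda>x. f x + g x)"
proof (induction k arbitrary: f g)
  case 0
  then show ?case by (simp add: continuous_map_add_euclidean)
next
  case (Suc k)
  show ?case unfolding Ck_on.simps
  proof (intro conjI allI impI)
    show "continuous_map (subtopology (Euclidean_space n) U) euclidean (\<lambda>x. f x + g x)"
      using Suc.prems by (simp add: continuous_map_add_euclidean)
    fix i assume "i < n"
    obtain f' where f': "\<And>x. x \<in> U \<Longrightarrow> ((\<lambda>t. f (x(i := t))) has_vector_derivative f' x) (at (x i))"
      and Cf': "Ck_on n k U f'" using Ck_on_SucE[OF Suc.prems(1) \<open>i < n\<close>] by blast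
    obtain g' where g': "\<And>x. x \<in> U \<Longrightarrow> ((\<lambda>t. g (x(i := t))) has_vector_derivative g' x) (at (x i))"
      and Cg': "Ck_on n k U g'" using Ck_on_SucE[OF Suc.prems(2) \<open>i < n\<close>] by blast
    from f' g' Cf' Cg' show "\<exists>h. (\<forall>x\<in>U. ((\<lambda>t. f (x(i := t)) + g (x(i := t))) has_vector_derivative h x) (at (x i))) \<and>
        Ck_on n k U h"
      using Suc.IH by (auto intro!: exI[of _ "\<lambda>x. f' x + g' x"] has_vector_derivative_add)
  qed
qed

lemma Ck_on_mult:
  fixes f g :: "(nat \<Rightarrow> real) \<Rightarrow> 'k::real_normed_algebra"
  shows "Ck_on n k U f \<Longrightarrow> Ck_on n k U g \<Longrightarrow> Ck_on n k U (\<lambda>x. f x * g x)"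
proof (induction k arbitrary: f g)
  case 0
  then show ?case by (simp add: continuous_map_mult_euclidean)
next
  case (Suc k)
  show ?case unfolding Ck_on.simps
  proof (intro conjI allI impI)
    show "continuous_map (subtopology (Euclidean_space n) U) euclidean (\<lambda>x. f x * g x)"
      using Suc.prems by (simp add: continuous_map_mult_euclidean)
    fix i assume "i < n"
    obtain f' where f': "\<And>x. x \<in> U \<Longrightarrow> ((\<lambda>t. f (x(i := t))) has_vector_derivative f' x) (at (x i))"
      and Cf': "Ck_on n k U f'" using Ck_on_SucE[OF Suc.prems(1) \<open>i < n\<close>] by blast
    obtain g' where g': "\<And>x. x \<in> U \<Longrightarrow> ((\<lambda>t. g (x(i := t))) has_vector_derivative g' x) (at (x i))"
      and Cg': "Ck_on n k U g'" using Ck_on_SucE[OF Suc.prems(2) \<open>i < n\<close>] by blast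
    have "((\<lambda>t. f (x(i := t)) * g (x(i := t))) has_vector_derivative f x * g' x + f' x * g x) (at (x i))"
      if "x \<in> U" for x
      using has_vector_derivative_mult[OF f'[OF that] g'[OF that]] by (simp only: fun_upd_triv)
    moreover have "Ck_on n k U (\<lambda>x. f x * g' x + f' x * g x)"
      using Cf' Cg' Suc.prems[THEN Ck_on_SucD] by (intro Ck_on_add Suc.IH)
    ultimately show "\<exists>h. (\<forall>x\<in>U. ((\<lambda>t. f (x(i := t)) * g (x(i := t))) has_vector_derivative h x) (at (x i))) \<and>
        Ck_on n k U h"
      by (intro exI[of _ "\<lambda>x. f x * g' x + f' x * g x"]) simp
  qed
qed

lemma continuous_map_update_coordinate:
  assumes "x \<in> topspace (Euclidean_space n)" "i < n"
  shows "continuous_map euclideanreal (Euclidean_space n) (\<lambda>t. x(i := t))"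
  using assms
  by (auto simp: Euclidean_space_def continuous_map_in_subtopology topspace_Euclidean_space
      continuous_map_componentwise_UNIV)

text \<open>A partial derivative at a point of \<open>U\<close> is taken along a whole coordinate line, most of which
  may lie outside \<open>U\<close>.  Since \<open>U\<close> is open, a neighbourhood of the point in this line lies in
  \<open>U\<close>, and that is all the derivative depends on.\<close>

lemma Ck_on_cong:
  assumes U: "openin (Euclidean_space n) U" and eq: "\<And>x. x \<in> U \<Longrightarrow> f x = g x"
    and f: "Ck_on n k U f"
  shows "Ck_on n k U g"
proof -
  have cont: "continuous_map (subtopology (Euclidean_space n) U) euclidean g"
    if "continuous_map (subtopology (Euclidean_space n) U) euclidean f"
    using that by (rule continuous_map_eq) (use eq in auto)
  show ?thesis
  proof (cases k)
    case 0
    then show ?thesis using f cont by simp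
  next
    case (Suc l)
    have "((\<lambda>t. g (x(i := t))) has_vector_derivative h x) (at (x i))"
      if "((\<lambda>t. f (x(i := t))) has_vector_derivative h x) (at (x i))" "i < n" "x \<in> U" for h x i
    proof -
      have "x \<in> topspace (Euclidean_space n)" using U \<open>x \<in> U\<close> openin_subset by blast
      then have "open {t. x(i := t) \<in> U}"
        using openin_continuous_map_preimage[OF continuous_map_update_coordinate U] \<open>i < n\<close> by auto
      then show ?thesis
        using that eq
        by (intro has_vector_derivative_transform_within_open[OF that(1)]) auto
    qed
    with f cont show ?thesis unfolding Suc Ck_on.simps by blast
  qed
qed

section \<open>Smooth functions on a manifold\<close>

lemma smooth_fun_on_iff_Ck:
  "smooth_fun_on M W f \<longleftrightarrow>
    (\<forall>U \<phi> k. (U, \<phi>) \<in> atlas M \<longrightarrow> Ck_on (mdim M) k (\<phi> ` (U \<inter> W)) (\<lambda>y. f (inv_into U \<phi> y)))"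
  unfolding smooth_fun_on_def Cinf_on_def by blast

lemma smooth_fun_on_subset: "smooth_fun_on M W f \<Longrightarrow> W' \<subseteq> W \<Longrightarrow> smooth_fun_on M W' f"
  unfolding smooth_fun_on_iff_Ck by (meson Ck_on_subset Int_mono image_mono order_refl)

lemma smooth_fun_on_const: "smooth_fun_on M W (\<lambda>x. c)"
  by (simp add: smooth_fun_on_iff_Ck Ck_on_const)

lemma smooth_fun_on_bounded_linear:
  "bounded_linear L \<Longrightarrow> smooth_fun_on M W f \<Longrightarrow> smooth_fun_on M W (\<lambda>x. L (f x))"
  unfolding smooth_fun_on_iff_Ck by (intro allI impI Ck_on_bounded_linear[of L]) auto

lemma smooth_fun_on_add:
  "smooth_fun_on M W f \<Longrightarrow> smooth_fun_on M W g \<Longrightarrow> smooth_fun_on M W (\<lambda>x. f x + g x)"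
  unfolding smooth_fun_on_iff_Ck by (intro allI impI Ck_on_add) auto

lemma smooth_fun_on_mult:
  fixes f g :: "'m \<Rightarrow> 'k::real_normed_algebra"
  shows "smooth_fun_on M W f \<Longrightarrow> smooth_fun_on M W g \<Longrightarrow> smooth_fun_on M W (\<lambda>x. f x * g x)"
  unfolding smooth_fun_on_iff_Ck by (intro allI impI Ck_on_mult) auto

lemma openin_chart_image:
  assumes "smooth_manifold M" "(U, \<phi>) \<in> atlas M" "openin (mtop M) W"
  shows "openin (Euclidean_space (mdim M)) (\<phi> ` (U \<inter> W))"
proof -
  have U: "openin (mtop M) U" "openin (Euclidean_space (mdim M)) (\<phi> ` U)"
    "homeomorphic_map (subtopology (mtop M) U)
          (subtopology (Euclidean_space (mdim M)) (\<phi> ` U)) \<phi>"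
    using assms unfolding smooth_manifold_def by blast+
  have "openin (subtopology (mtop M) U) (U \<inter> W)"
    using U(1) assms(3) by (simp add: openin_open_subtopology openin_Int)
  then have "openin (subtopology (Euclidean_space (mdim M)) (\<phi> ` U)) (\<phi> ` (U \<inter> W))"
    using homeomorphic_imp_open_map[OF U(3)] by (simp add: open_map_def)
  then show ?thesis using U(2) by (simp add: openin_open_subtopology)
qed

text \<open>Sections are restricted to the points of \<open>M\<close>, and identities such as linearity of a
  trivialization hold only over its domain; this lemma lets such formulas be used for proving
  smoothness.\<close>

lemma smooth_fun_on_cong:
  assumes "smooth_manifold M" "openin (mtop M) W" "\<And>x. x \<in> W \<Longrightarrow> f x = g x"
    and f: "smooth_fun_on M W f"
  shows "smooth_fun_on M W g"
  unfolding smooth_fun_on_def Cinf_on_def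
proof (clarify)
  fix U \<phi> k assume c: "(U, \<phi>) \<in> atlas M"
  have eq: "f (inv_into U \<phi> y) = g (inv_into U \<phi> y)" if "y \<in> \<phi> ` (U \<inter> W)" for y
  proof -
    have "openin (mtop M) U" "homeomorphic_map (subtopology (mtop M) U)
        (subtopology (Euclidean_space (mdim M)) (\<phi> ` U)) \<phi>"
      using assms(1) c unfolding smooth_manifold_def by blast+
    then have "inj_on \<phi> U"
      using homeomorphic_imp_injective_map openin_subset topspace_subtopology_subset by metis
    then show ?thesis using that assms(3) by auto
  qed
  have "Ck_on (mdim M) k (\<phi> ` (U \<inter> W)) (\<lambda>y. f (inv_into U \<phi> y))"
    using f c by (simp add: smooth_fun_on_iff_Ck)
  then show "Ck_on (mdim M) k (\<phi> ` (U \<inter> W)) (\<lambda>y. g (inv_into U \<phi> y))"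
    by (rule Ck_on_cong[OF openin_chart_image[OF assms(1) c assms(2)], rotated]) (rule eq)
qed

lemma smooth_fun_on_Complex_iff:
  "smooth_fun_on M W (\<lambda>x. Complex (f x) (g x)) \<longleftrightarrow> smooth_fun_on M W f \<and> smooth_fun_on M W g"
proof safe
  assume c: "smooth_fun_on M W (\<lambda>x. Complex (f x) (g x))"
  show "smooth_fun_on M W f"
    using smooth_fun_on_bounded_linear[OF bounded_linear_Re c] by simp
  show "smooth_fun_on M W g"
    using smooth_fun_on_bounded_linear[OF bounded_linear_Im c] by simp
next
  assume "smooth_fun_on M W f" "smooth_fun_on M W g"
  then have "smooth_fun_on M W (\<lambda>x. of_real (f x) + \<i> * of_real (g x))"
    by (intro smooth_fun_on_add smooth_fun_on_mult smooth_fun_on_const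
        smooth_fun_on_bounded_linear[OF bounded_linear_of_real])
  then show "smooth_fun_on M W (\<lambda>x. Complex (f x) (g x))"
    by (simp add: Complex_eq)
qed

section \<open>Vector spaces, linear maps and complexification\<close>

text \<open>Vector spaces whose scalars are all elements of a field type: the module laws then hold with the
  arithmetic of the type and without carrier conditions on the scalars.\<close>

locale vspace = Module.module "ring_of_type_algebra" V
  for V :: "('k::field, 'v) module"
begin

lemma smult_in [simp]: "x \<in> carrier V \<Longrightarrow> c \<odot>\<^bsub>V\<^esub> x \<in> carrier V"
  by (rule smult_closed) (simp_all add: ring_of_type_algebra_def)

lemma smult_add_left:
  "x \<in> carrier V \<Longrightarrow> (c + d) \<odot>\<^bsub>V\<^esub> x = c \<odot>\<^bsub>V\<^esub> x \<oplus>\<^bsub>V\<^esub> d \<odot>\<^bsub>V\<^esub> x"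
  using smult_l_distr[of c d x] by (simp add: ring_of_type_algebra_def)

lemma smult_add_right:
  "x \<in> carrier V \<Longrightarrow> y \<in> carrier V \<Longrightarrow> c \<odot>\<^bsub>V\<^esub> (x \<oplus>\<^bsub>V\<^esub> y) = c \<odot>\<^bsub>V\<^esub> x \<oplus>\<^bsub>V\<^esub> c \<odot>\<^bsub>V\<^esub> y"
  using smult_r_distr[of c x y] by (simp add: ring_of_type_algebra_def)

lemma smult_smult: "x \<in> carrier V \<Longrightarrow> c \<odot>\<^bsub>V\<^esub> (d \<odot>\<^bsub>V\<^esub> x) = (c * d) \<odot>\<^bsub>V\<^esub> x"
  using smult_assoc1[of c d x] by (simp add: ring_of_type_algebra_def)

lemma smult_1 [simp]: "x \<in> carrier V \<Longrightarrow> 1 \<odot>\<^bsub>V\<^esub> x = x"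
  using smult_one[of x] by (simp add: ring_of_type_algebra_def)

lemma smult_0 [simp]: "x \<in> carrier V \<Longrightarrow> 0 \<odot>\<^bsub>V\<^esub> x = \<zero>\<^bsub>V\<^esub>"
  using smult_l_null[of x] by (simp add: ring_of_type_algebra_def)

lemma smult_zero [simp]: "c \<odot>\<^bsub>V\<^esub> \<zero>\<^bsub>V\<^esub> = \<zero>\<^bsub>V\<^esub>"
  using smult_r_null[of c] by (simp add: ring_of_type_algebra_def)

text \<open>Negation is a definite description, which does not evaluate pointwise in a space of sections or
  componentwise in a complexification; a scalar multiple does.\<close>

lemma minus_conv_smult: "x \<in> carrier V \<Longrightarrow> \<ominus>\<^bsub>V\<^esub> x = (- 1) \<odot>\<^bsub>V\<^esub> x"
  using smult_add_left[of x "- 1" 1] by (intro minus_equality) simp_all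

lemma diff_conv_smult:
  "y \<in> carrier V \<Longrightarrow> x \<ominus>\<^bsub>V\<^esub> y = x \<oplus>\<^bsub>V\<^esub> (- 1) \<odot>\<^bsub>V\<^esub> y"
  by (simp add: a_minus_def minus_conv_smult)

lemma diff_eq_zeroD:
  "x \<ominus>\<^bsub>V\<^esub> y = \<zero>\<^bsub>V\<^esub> \<Longrightarrow> x \<in> carrier V \<Longrightarrow> y \<in> carrier V \<Longrightarrow> x = y"
  using minus_equality[of x "\<ominus>\<^bsub>V\<^esub> y"] by (simp add: a_minus_def M.minus_minus)

lemmas vspace_simps = a_closed M.zero_closed a_ac M.l_zero M.r_zero
  smult_in smult_add_left smult_add_right smult_smult smult_1 smult_0 smult_zero diff_conv_smult

end

lemma vspaceI:
  fixes V :: "('k::field, 'v) module"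
  assumes "\<And>x y. x \<in> carrier V \<Longrightarrow> y \<in> carrier V \<Longrightarrow> x \<oplus>\<^bsub>V\<^esub> y \<in> carrier V"
    and "\<zero>\<^bsub>V\<^esub> \<in> carrier V"
    and "\<And>c x. x \<in> carrier V \<Longrightarrow> c \<odot>\<^bsub>V\<^esub> x \<in> carrier V"
    and "\<And>x y z. x \<in> carrier V \<Longrightarrow> y \<in> carrier V \<Longrightarrow> z \<in> carrier V \<Longrightarrow>
           (x \<oplus>\<^bsub>V\<^esub> y) \<oplus>\<^bsub>V\<^esub> z = x \<oplus>\<^bsub>V\<^esub> (y \<oplus>\<^bsub>V\<^esub> z)"
    and "\<And>x y. x \<in> carrier V \<Longrightarrow> y \<in> carrier V \<Longrightarrow> x \<oplus>\<^bsub>V\<^esub> y = y \<oplus>\<^bsub>V\<^esub> x"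
    and "\<And>x. x \<in> carrier V \<Longrightarrow> \<zero>\<^bsub>V\<^esub> \<oplus>\<^bsub>V\<^esub> x = x"
    and "\<And>x. x \<in> carrier V \<Longrightarrow> 0 \<odot>\<^bsub>V\<^esub> x = \<zero>\<^bsub>V\<^esub>"
    and "\<And>x. x \<in> carrier V \<Longrightarrow> 1 \<odot>\<^bsub>V\<^esub> x = x"
    and "\<And>c d x. x \<in> carrier V \<Longrightarrow> (c + d) \<odot>\<^bsub>V\<^esub> x = c \<odot>\<^bsub>V\<^esub> x \<oplus>\<^bsub>V\<^esub> d \<odot>\<^bsub>V\<^esub> x"
    and "\<And>c x y. x \<in> carrier V \<Longrightarrow> y \<in> carrier V \<Longrightarrow>
           c \<odot>\<^bsub>V\<^esub> (x \<oplus>\<^bsub>V\<^esub> y) = c \<odot>\<^bsub>V\<^esub> x \<oplus>\<^bsub>V\<^esub> c \<odot>\<^bsub>V\<^esub> y"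
    and "\<And>c d x. x \<in> carrier V \<Longrightarrow> (c * d) \<odot>\<^bsub>V\<^esub> x = c \<odot>\<^bsub>V\<^esub> (d \<odot>\<^bsub>V\<^esub> x)"
  shows "vspace V"
proof -
  have "(- 1) \<odot>\<^bsub>V\<^esub> x \<oplus>\<^bsub>V\<^esub> x = \<zero>\<^bsub>V\<^esub>" if "x \<in> carrier V" for x
    using that assms(9)[of x "- 1" 1] assms(7,8) by simp
  then have "\<exists>y\<in>carrier V. y \<oplus>\<^bsub>V\<^esub> x = \<zero>\<^bsub>V\<^esub>" if "x \<in> carrier V" for x
    using that assms(3) by blast
  then have "abelian_group V"
    using assms(1,2,4-6) by (intro abelian_groupI) blast+
  then have "Module.module (ring_of_type_algebra :: 'k ring) V"
    using assms by (intro moduleI cring_from_type_algebra) (simp_all add: ring_of_type_algebra_def)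
  then show ?thesis by (simp add: vspace_def)
qed

lemma linear_on_in: "linear_on V W h \<Longrightarrow> x \<in> carrier V \<Longrightarrow> h x \<in> carrier W"
  by (auto simp: linear_on_def)

lemma linear_on_add:
  "linear_on V W h \<Longrightarrow> x \<in> carrier V \<Longrightarrow> y \<in> carrier V \<Longrightarrow> h (x \<oplus>\<^bsub>V\<^esub> y) = h x \<oplus>\<^bsub>W\<^esub> h y"
  by (auto simp: linear_on_def)

lemma linear_on_smult:
  "linear_on V W h \<Longrightarrow> x \<in> carrier V \<Longrightarrow> h (c \<odot>\<^bsub>V\<^esub> x) = c \<odot>\<^bsub>W\<^esub> h x"
  by (auto simp: linear_on_def)

lemma linear_on_zero:
  assumes "vspace V" "vspace W" "linear_on V W h"
  shows "h \<zero>\<^bsub>V\<^esub> = \<zero>\<^bsub>W\<^esub>"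
proof -
  interpret V: vspace V by fact
  interpret W: vspace W by fact
  have "h (0 \<odot>\<^bsub>V\<^esub> \<zero>\<^bsub>V\<^esub>) = 0 \<odot>\<^bsub>W\<^esub> h \<zero>\<^bsub>V\<^esub>"
    using assms(3) by (rule linear_on_smult) simp
  then show ?thesis using linear_on_in[OF assms(3)] by simp
qed

lemma linear_on_minus:
  assumes "vspace V" "vspace W" "linear_on V W h" "x \<in> carrier V"
  shows "h (\<ominus>\<^bsub>V\<^esub> x) = \<ominus>\<^bsub>W\<^esub> h x"
  using assms by (simp add: vspace.minus_conv_smult linear_on_in linear_on_smult)

lemma linear_on_diff:
  assumes "vspace V" "vspace W" "linear_on V W h" "x \<in> carrier V" "y \<in> carrier V"
  shows "h (x \<ominus>\<^bsub>V\<^esub> y) = h x \<ominus>\<^bsub>W\<^esub> h y"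
proof -
  interpret V: vspace V by fact
  interpret W: vspace W by fact
  show ?thesis
    using assms by (simp add: V.diff_conv_smult W.diff_conv_smult linear_on_in linear_on_add linear_on_smult)
qed

lemma linear_on_compose:
  "linear_on V W h \<Longrightarrow> linear_on W X' g \<Longrightarrow> linear_on V X' (\<lambda>x. g (h x))"
  by (auto simp: linear_on_def Pi_iff)

lemma complexify_sel [simp]:
  "carrier (complexify_space V) = carrier V \<times> carrier V"
  "\<zero>\<^bsub>complexify_space V\<^esub> = (\<zero>\<^bsub>V\<^esub>, \<zero>\<^bsub>V\<^esub>)"
  "(a, b) \<oplus>\<^bsub>complexify_space V\<^esub> (c, d) = (a \<oplus>\<^bsub>V\<^esub> c, b \<oplus>\<^bsub>V\<^esub> d)"
  "z \<odot>\<^bsub>complexify_space V\<^esub> (a, b) =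
     ((Re z \<odot>\<^bsub>V\<^esub> a) \<ominus>\<^bsub>V\<^esub> (Im z \<odot>\<^bsub>V\<^esub> b), (Re z \<odot>\<^bsub>V\<^esub> b) \<oplus>\<^bsub>V\<^esub> (Im z \<odot>\<^bsub>V\<^esub> a))"
  by (simp_all add: complexify_space_def)

context
  fixes V :: "(real, 'v) module"
  assumes "vspace V"
begin

interpretation vspace V by fact

lemma vspace_complexify: "vspace (complexify_space V)"
proof (rule vspaceI)
  fix c :: complex and x y assume "x \<in> carrier (complexify_space V)" "y \<in> carrier (complexify_space V)"
  then show "c \<odot>\<^bsub>complexify_space V\<^esub> (x \<oplus>\<^bsub>complexify_space V\<^esub> y) =
      c \<odot>\<^bsub>complexify_space V\<^esub> x \<oplus>\<^bsub>complexify_space V\<^esub> c \<odot>\<^bsub>complexify_space V\<^esub> y"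
    by (auto simp: diff_conv_smult smult_add_right smult_smult a_ac)
next
  fix c d :: complex and x assume "x \<in> carrier (complexify_space V)"
  then show "(c + d) \<odot>\<^bsub>complexify_space V\<^esub> x =
      c \<odot>\<^bsub>complexify_space V\<^esub> x \<oplus>\<^bsub>complexify_space V\<^esub> d \<odot>\<^bsub>complexify_space V\<^esub> x"
    by (auto simp: diff_conv_smult smult_add_left smult_add_right smult_smult a_ac)
next
  fix c d :: complex and x assume "x \<in> carrier (complexify_space V)"
  then obtain a b where x: "x = (a, b)" "a \<in> carrier V" "b \<in> carrier V" by auto
  have [simp]: "(p - q) \<odot>\<^bsub>V\<^esub> u = p \<odot>\<^bsub>V\<^esub> u \<oplus>\<^bsub>V\<^esub> (- q) \<odot>\<^bsub>V\<^esub> u"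
    if "u \<in> carrier V" for p q u
    using smult_add_left[OF that, of p "- q"] by simp
  show "(c * d) \<odot>\<^bsub>complexify_space V\<^esub> x =
      c \<odot>\<^bsub>complexify_space V\<^esub> (d \<odot>\<^bsub>complexify_space V\<^esub> x)"
    using x by (simp add: diff_conv_smult smult_add_left smult_add_right smult_smult a_ac)
qed (auto simp: diff_conv_smult a_ac)

lemma minus_complexify:
  "a \<in> carrier V \<Longrightarrow> b \<in> carrier V \<Longrightarrow>
    \<ominus>\<^bsub>complexify_space V\<^esub> (a, b) = (\<ominus>\<^bsub>V\<^esub> a, \<ominus>\<^bsub>V\<^esub> b)"
  using vspace.minus_conv_smult[OF vspace_complexify, of "(a, b)"]
  by (simp add: minus_conv_smult diff_conv_smult)

lemma complexify_decompose:
  "a \<in> carrier V \<Longrightarrow> b \<in> carrier V \<Longrightarrow>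
    (a, b) = (a, \<zero>\<^bsub>V\<^esub>) \<oplus>\<^bsub>complexify_space V\<^esub> \<i> \<odot>\<^bsub>complexify_space V\<^esub> (b, \<zero>\<^bsub>V\<^esub>)"
  by (simp add: diff_conv_smult)

text \<open>A complex-linear map is determined by its values on the real vectors \<open>(a, 0)\<close>.  The codomain
  is arbitrary, so this applies to either argument of a bracket.\<close>

lemma linear_on_complexify_decompose:
  assumes h: "linear_on (complexify_space V) W h" and ab: "a \<in> carrier V" "b \<in> carrier V"
  shows "h (a, b) = h (a, \<zero>\<^bsub>V\<^esub>) \<oplus>\<^bsub>W\<^esub> \<i> \<odot>\<^bsub>W\<^esub> h (b, \<zero>\<^bsub>V\<^esub>)"
proof -
  interpret C: vspace "complexify_space V" by (rule vspace_complexify)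
  have real: "(a, \<zero>\<^bsub>V\<^esub>) \<in> carrier (complexify_space V)" "(b, \<zero>\<^bsub>V\<^esub>) \<in> carrier (complexify_space V)"
    using ab by simp_all
  show ?thesis
    unfolding complexify_decompose[OF ab]
    by (simp only: linear_on_add[OF h real(1) C.smult_in[OF real(2)]] linear_on_smult[OF h real(2)])
qed

end

section \<open>Real and imaginary parts of complex-linear maps and brackets\<close>

text \<open>A real vector \<open>a\<close> is the pair \<open>(a, 0)\<close>; the argument \<open>V\<close> supplies the zero.\<close>

definition re_part :: "('a, 'v) module \<Rightarrow> ('v \<times> 'v \<Rightarrow> 'w \<times> 'w) \<Rightarrow> 'v \<Rightarrow> 'w" where
  "re_part V h a = fst (h (a, \<zero>\<^bsub>V\<^esub>))"

definition im_part :: "('a, 'v) module \<Rightarrow> ('v \<times> 'v \<Rightarrow> 'w \<times> 'w) \<Rightarrow> 'v \<Rightarrow> 'w" where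
  "im_part V h a = snd (h (a, \<zero>\<^bsub>V\<^esub>))"

text \<open>The formula for \<open>h (a, b)\<close> is \<open>h (a + \<i>b) = (h\<^sub>1 a + \<i> h\<^sub>2 a) + \<i> (h\<^sub>1 b + \<i> h\<^sub>2 b)\<close>.  Applied to an anchor
  it is the anchor of the complex sum.\<close>

lemma
  fixes V :: "(real, 'v) module" and W :: "(real, 'w) module"
  assumes V: "vspace V" and W: "vspace W" 
    and h: "linear_on (complexify_space V) (complexify_space W) h"
  shows linear_on_re_part: "linear_on V W (re_part V h)"
    and linear_on_im_part: "linear_on V W (im_part V h)"
    and linear_on_complexify_eq:
      "a \<in> carrier V \<Longrightarrow> b \<in> carrier V \<Longrightarrow>
       h (a, b) = (re_part V h a \<ominus>\<^bsub>W\<^esub> im_part V h b, re_part V h b \<oplus>\<^bsub>W\<^esub> im_part V h a)"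
proof -
  interpret V: vspace V by fact
  interpret W: vspace W by fact
  have eq: "h (a, \<zero>\<^bsub>V\<^esub>) = (re_part V h a, im_part V h a)" for a
    by (simp add: re_part_def im_part_def)
  have in_W: "re_part V h a \<in> carrier W" "im_part V h a \<in> carrier W" if "a \<in> carrier V" for a
    using linear_on_in[OF h, of "(a, \<zero>\<^bsub>V\<^esub>)"] that by (simp_all add: eq)
  have add: "re_part V h (a \<oplus>\<^bsub>V\<^esub> b) = re_part V h a \<oplus>\<^bsub>W\<^esub> re_part V h b \<and>
      im_part V h (a \<oplus>\<^bsub>V\<^esub> b) = im_part V h a \<oplus>\<^bsub>W\<^esub> im_part V h b"
    if "a \<in> carrier V" "b \<in> carrier V" for a b
    using linear_on_add[OF h, of "(a, \<zero>\<^bsub>V\<^esub>)" "(b, \<zero>\<^bsub>V\<^esub>)"] that by (simp add: eq)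
  have smult: "re_part V h (c \<odot>\<^bsub>V\<^esub> a) = c \<odot>\<^bsub>W\<^esub> re_part V h a \<and>
      im_part V h (c \<odot>\<^bsub>V\<^esub> a) = c \<odot>\<^bsub>W\<^esub> im_part V h a"
    if "a \<in> carrier V" for c a
    using linear_on_smult[OF h, of "(a, \<zero>\<^bsub>V\<^esub>)" "of_real c"] that in_W
    by (simp add: eq V.diff_conv_smult W.diff_conv_smult)
  show "linear_on V W (re_part V h)" "linear_on V W (im_part V h)"
    using in_W add smult by (auto simp: linear_on_def)
  assume ab: "a \<in> carrier V" "b \<in> carrier V"
  show "h (a, b) = (re_part V h a \<ominus>\<^bsub>W\<^esub> im_part V h b, re_part V h b \<oplus>\<^bsub>W\<^esub> im_part V h a)"
    using ab in_W linear_on_complexify_decompose[OF V h ab]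
    by (simp add: eq W.diff_conv_smult W.a_ac)
qed

abbreviation re_bracket ::
  "(real, 'v) module \<Rightarrow> ('v \<times> 'v \<Rightarrow> 'v \<times> 'v \<Rightarrow> 'v \<times> 'v) \<Rightarrow> 'v \<Rightarrow> 'v \<Rightarrow> 'v" where
  "re_bracket V B a b \<equiv> re_part V (B (a, \<zero>\<^bsub>V\<^esub>)) b"

abbreviation im_bracket ::
  "(real, 'v) module \<Rightarrow> ('v \<times> 'v \<Rightarrow> 'v \<times> 'v \<Rightarrow> 'v \<times> 'v) \<Rightarrow> 'v \<Rightarrow> 'v \<Rightarrow> 'v" where
  "im_bracket V B a b \<equiv> im_part V (B (a, \<zero>\<^bsub>V\<^esub>)) b"

lemma skew_bilinearD:
  assumes "skew_bilinear V br" "a \<in> carrier V"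
  shows "linear_on V V (br a)" "linear_on V V (\<lambda>b. br b a)"
    and "b \<in> carrier V \<Longrightarrow> br a b = \<ominus>\<^bsub>V\<^esub> br b a"
  using assms unfolding skew_bilinear_def by blast+

context
  fixes V :: "(real, 'v) module" and B
  assumes V: "vspace V" and B: "skew_bilinear (complexify_space V) B"
begin

interpretation V: vspace V by fact
interpretation C: vspace "complexify_space V" using V by (rule vspace_complexify)

lemma real_vector_in_complexify: "a \<in> carrier V \<Longrightarrow> (a, \<zero>\<^bsub>V\<^esub>) \<in> carrier (complexify_space V)"
  by simp

lemma bracket_real_vectors:
  "B (a, \<zero>\<^bsub>V\<^esub>) (b, \<zero>\<^bsub>V\<^esub>) = (re_bracket V B a b, im_bracket V B a b)"
  by (simp add: re_part_def im_part_def)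

lemma
  assumes "a \<in> carrier V"
  shows linear_on_re_bracket: "linear_on V V (re_bracket V B a)"
    and linear_on_im_bracket: "linear_on V V (im_bracket V B a)"
  using skew_bilinearD(1)[OF B real_vector_in_complexify[OF assms]]
  by (simp_all add: linear_on_re_part linear_on_im_part V)

lemma
  assumes a: "a \<in> carrier V" and b: "b \<in> carrier V"
  shows re_bracket_in [simp]: "re_bracket V B a b \<in> carrier V"
    and im_bracket_in [simp]: "im_bracket V B a b \<in> carrier V"
  using linear_on_in[OF linear_on_re_bracket[OF a] b]
    linear_on_in[OF linear_on_im_bracket[OF a] b] by simp_all

lemma
  shows skew_bilinear_re_bracket: "skew_bilinear V (re_bracket V B)"
    and skew_bilinear_im_bracket: "skew_bilinear V (im_bracket V B)"
proof -
  have lin: "linear_on V V (\<lambda>b. re_bracket V B b a) \<and> linear_on V V (\<lambda>b. im_bracket V B b a)"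
    if "a \<in> carrier V" for a
    using skew_bilinearD(2)[OF B real_vector_in_complexify[OF that]]
      linear_on_re_part[OF V V, of "\<lambda>u. B u (a, \<zero>\<^bsub>V\<^esub>)"]
      linear_on_im_part[OF V V, of "\<lambda>u. B u (a, \<zero>\<^bsub>V\<^esub>)"]
    by (simp add: re_part_def[abs_def] im_part_def[abs_def])
  have skew: "re_bracket V B a b = \<ominus>\<^bsub>V\<^esub> re_bracket V B b a \<and>
      im_bracket V B a b = \<ominus>\<^bsub>V\<^esub> im_bracket V B b a"
    if "a \<in> carrier V" "b \<in> carrier V" for a b
    using skew_bilinearD(3)[OF B real_vector_in_complexify real_vector_in_complexify, OF that] that
    by (simp add: bracket_real_vectors minus_complexify V)
  show "skew_bilinear V (re_bracket V B)" "skew_bilinear V (im_bracket V B)"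
    using lin skew linear_on_re_bracket linear_on_im_bracket unfolding skew_bilinear_def by blast+
qed

lemma bracket_eq_complex_sum:
  assumes "a \<in> carrier V" "b \<in> carrier V" "c \<in> carrier V" "d \<in> carrier V"
  defines "br \<equiv> \<lambda>a b. (re_bracket V B a b, im_bracket V B a b)"
  shows "B (a, b) (c, d) =
    (br a c \<ominus>\<^bsub>complexify_space V\<^esub> br b d) \<oplus>\<^bsub>complexify_space V\<^esub>
    \<i> \<odot>\<^bsub>complexify_space V\<^esub> (br a d \<oplus>\<^bsub>complexify_space V\<^esub> br b c)"
proof -
  have left: "B (p, q) u = B (p, \<zero>\<^bsub>V\<^esub>) u \<oplus>\<^bsub>complexify_space V\<^esub>
      \<i> \<odot>\<^bsub>complexify_space V\<^esub> B (q, \<zero>\<^bsub>V\<^esub>) u"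
    if "p \<in> carrier V" "q \<in> carrier V" "u \<in> carrier (complexify_space V)" for p q u
    using linear_on_complexify_decompose[OF V skew_bilinearD(2)[OF B that(3)] that(1,2)] .
  have right: "B u (p, q) = B u (p, \<zero>\<^bsub>V\<^esub>) \<oplus>\<^bsub>complexify_space V\<^esub>
      \<i> \<odot>\<^bsub>complexify_space V\<^esub> B u (q, \<zero>\<^bsub>V\<^esub>)"
    if "p \<in> carrier V" "q \<in> carrier V" "u \<in> carrier (complexify_space V)" for p q u
    using linear_on_complexify_decompose[OF V skew_bilinearD(1)[OF B that(3)] that(1,2)] .
  have in_C: "br p q \<in> carrier (complexify_space V)" if "p \<in> carrier V" "q \<in> carrier V" for p q
    using that by (simp add: br_def)
  have "B (a, b) (c, d) = (br a c \<oplus>\<^bsub>complexify_space V\<^esub> \<i> \<odot>\<^bsub>complexify_space V\<^esub> br a d)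
      \<oplus>\<^bsub>complexify_space V\<^esub> \<i> \<odot>\<^bsub>complexify_space V\<^esub>
        (br b c \<oplus>\<^bsub>complexify_space V\<^esub> \<i> \<odot>\<^bsub>complexify_space V\<^esub> br b d)"
    using left[OF assms(1,2), of "(c, d)"] right[OF assms(3,4) real_vector_in_complexify[OF assms(1)]]
      right[OF assms(3,4) real_vector_in_complexify[OF assms(2)]] assms(3,4)
    unfolding br_def bracket_real_vectors[symmetric] by simp
  also have "\<dots> = (br a c \<ominus>\<^bsub>complexify_space V\<^esub> br b d) \<oplus>\<^bsub>complexify_space V\<^esub>
    \<i> \<odot>\<^bsub>complexify_space V\<^esub> (br a d \<oplus>\<^bsub>complexify_space V\<^esub> br b c)"
    using in_C assms(1-4)
    by (simp add: C.diff_conv_smult C.smult_add_right C.smult_smult C.a_ac del: complexify_sel)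
  finally show ?thesis .
qed

text \<open>Each nested bracket of real vectors expands as
  \<open>[a, [b, c]] = [a, [b, c]\<^sub>1]\<^sub>1 - [a, [b, c]\<^sub>2]\<^sub>2 + \<i> ([a, [b, c]\<^sub>2]\<^sub>1 + [a, [b, c]\<^sub>1]\<^sub>2)\<close>.
  Hence the Jacobi identity contains both conditions on a complex matched pair: its real part says
  that the Jacobiators agree, its imaginary part that the brackets commute.\<close>

lemma jacobiator_real_vectors:
  assumes abc: "a \<in> carrier V" "b \<in> carrier V" "c \<in> carrier V"
  shows "jacobiator (complexify_space V) B (a, \<zero>\<^bsub>V\<^esub>) (b, \<zero>\<^bsub>V\<^esub>) (c, \<zero>\<^bsub>V\<^esub>) =
    (jacobiator V (re_bracket V B) a b c \<ominus>\<^bsub>V\<^esub> jacobiator V (im_bracket V B) a b c,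
     cyclic_sum V (im_bracket V B) (re_bracket V B) a b c \<oplus>\<^bsub>V\<^esub>
     cyclic_sum V (re_bracket V B) (im_bracket V B) a b c)"
proof -
  have nested: "B (p, \<zero>\<^bsub>V\<^esub>) (B (q, \<zero>\<^bsub>V\<^esub>) (r, \<zero>\<^bsub>V\<^esub>)) =
      (re_bracket V B p (re_bracket V B q r) \<ominus>\<^bsub>V\<^esub> im_bracket V B p (im_bracket V B q r),
       re_bracket V B p (im_bracket V B q r) \<oplus>\<^bsub>V\<^esub> im_bracket V B p (re_bracket V B q r))"
    if "p \<in> carrier V" "q \<in> carrier V" "r \<in> carrier V" for p q r
    using that skew_bilinearD(1)[OF B real_vector_in_complexify[of p]]
    by (simp only: bracket_real_vectors linear_on_complexify_eq[OF V V] re_bracket_in im_bracket_in)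
  show ?thesis
    unfolding cyclic_sum_def nested[OF abc(1,2,3)] nested[OF abc(2,3,1)] nested[OF abc(3,1,2)]
    using abc by (simp add: V.diff_conv_smult V.smult_add_right V.a_ac)
qed

end

text \<open>The results on brackets on \<open>complexify_space V\<close> are carried over to brackets on the sections of a
  complexified bundle, which are functions with values in pairs rather than pairs of functions.\<close>

lemma skew_bilinear_transport:
  assumes V: "vspace V" and W: "vspace W"
    and P: "linear_on V W P" and Q: "linear_on W V Q" and br: "skew_bilinear W br"
  shows "skew_bilinear V (\<lambda>u v. Q (br (P u) (P v)))"
proof -
  have "linear_on V V (\<lambda>v. Q (br (P u) (P v)))" "linear_on V V (\<lambda>v. Q (br (P v) (P u)))"
    if "u \<in> carrier V" for u
    using skew_bilinearD(1,2)[OF br linear_on_in[OF P that]] P Q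
    by (auto intro: linear_on_compose[OF linear_on_compose])
  moreover have "Q (br (P u) (P v)) = \<ominus>\<^bsub>V\<^esub> Q (br (P v) (P u))"
    if "u \<in> carrier V" "v \<in> carrier V" for u v
  proof -
    have "br (P v) (P u) \<in> carrier W"
      using skew_bilinearD(1)[OF br] linear_on_in P that by metis
    then show ?thesis
      using skew_bilinearD(3)[OF br] linear_on_in[OF P] that linear_on_minus[OF W V Q] by metis
  qed
  ultimately show ?thesis unfolding skew_bilinear_def by blast
qed

lemma jacobiator_transport:
  assumes V: "vspace V" and W: "vspace W"
    and P: "linear_on V W P" and Q: "linear_on W V Q" and br: "skew_bilinear W br"
    and PQ: "\<And>w. w \<in> carrier W \<Longrightarrow> P (Q w) = w"
    and uvw: "u \<in> carrier V" "v \<in> carrier V" "w \<in> carrier V"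
  shows "jacobiator V (\<lambda>u v. Q (br (P u) (P v))) u v w = Q (jacobiator W br (P u) (P v) (P w))"
proof -
  interpret W: vspace W by fact
  have in_W: "br a b \<in> carrier W" if "a \<in> carrier W" "b \<in> carrier W" for a b
    using linear_on_in[OF skew_bilinearD(1)[OF br that(1)] that(2)] .
  show ?thesis
    using linear_on_in[OF P] uvw
    by (simp add: cyclic_sum_def PQ in_W linear_on_add[OF Q])
qed

section \<open>Tangent spaces\<close>

lemma smooth_nearI: "openin (mtop M) W \<Longrightarrow> p \<in> W \<Longrightarrow> smooth_fun_on M W f \<Longrightarrow> f \<in> smooth_near M p"
  unfolding smooth_near_def by blast

lemma smooth_nearE:
  assumes "f \<in> smooth_near M p"
  obtains W where "openin (mtop M) W" "p \<in> W" "smooth_fun_on M W f"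
  using assms unfolding smooth_near_def by blast

lemma smooth_near_smult: "f \<in> smooth_near M p \<Longrightarrow> (\<lambda>q. c * f q) \<in> smooth_near M p"
  by (erule smooth_nearE) (rule smooth_nearI, assumption+, rule smooth_fun_on_mult[OF smooth_fun_on_const], assumption)

lemma
  assumes f: "f \<in> smooth_near M p" and g: "g \<in> smooth_near M p"
  shows smooth_near_add: "(\<lambda>q. f q + g q) \<in> smooth_near M p"
    and smooth_near_mult: "(\<lambda>q. f q * g q) \<in> smooth_near M p"
proof -
  obtain W where W: "openin (mtop M) W" "p \<in> W" "smooth_fun_on M W f"
    using f by (rule smooth_nearE)
  obtain W' where W': "openin (mtop M) W'" "p \<in> W'" "smooth_fun_on M W' g"
    using g by (rule smooth_nearE)
  have I: "openin (mtop M) (W \<inter> W')" "p \<in> W \<inter> W'"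
    and fg: "smooth_fun_on M (W \<inter> W') f" "smooth_fun_on M (W \<inter> W') g"
    using W W' by (auto intro: smooth_fun_on_subset)
  show "(\<lambda>q. f q + g q) \<in> smooth_near M p"
    by (rule smooth_nearI[OF I smooth_fun_on_add[OF fg]])
  show "(\<lambda>q. f q * g q) \<in> smooth_near M p"
    by (rule smooth_nearI[OF I smooth_fun_on_mult[OF fg]])
qed

text \<open>A sum of derivations is defined by its values on functions smooth near \<open>p\<close>.  It obeys the rules
  of a derivation because sums, multiples and products of such functions are again of this kind.\<close>

lemma vspace_tangent_space: "vspace (tangent_space M p)"
  by (rule vspaceI)
    (auto simp: tangent_space_def smooth_near_add smooth_near_mult smooth_near_smult
      extensional_def fun_eq_iff algebra_simps)

lemma tangent_vector_zero_fun:
  assumes "v \<in> carrier (tangent_space M p)" "f \<in> smooth_near M p"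
  shows "v (\<lambda>q. 0) = 0"
proof -
  have "\<forall>c. \<forall>f\<in>smooth_near M p. v (\<lambda>q. c * f q) = c * v f"
    using assms(1) by (simp add: tangent_space_def)
  from bspec[OF spec[OF this, of 0] assms(2)] show ?thesis by simp
qed

section \<open>The vector space of smooth sections\<close>

lemma vector_bundleD:
  assumes "vector_bundle M E"
  shows "smooth_manifold M"
    and "x \<in> points M \<Longrightarrow> vspace (fibre E x)"
    and "(U, \<Phi>) \<in> trivs E \<Longrightarrow> openin (mtop M) U"
    and "(U, \<Phi>) \<in> trivs E \<Longrightarrow> x \<in> U \<Longrightarrow> x \<in> points M"
    and "(U, \<Phi>) \<in> trivs E \<Longrightarrow> x \<in> U \<Longrightarrow> linear_on (fibre E x) (coord_space (vrank E)) (\<Phi> x)"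
  using assms openin_subset[of "mtop M" U] unfolding vector_bundle_def vspace_def by blast+

lemma triv_zero:
  assumes "vector_bundle M E" "(U, \<Phi>) \<in> trivs E" "x \<in> U"
  shows "\<Phi> x \<zero>\<^bsub>fibre E x\<^esub> i = 0"
proof -
  interpret vspace "fibre E x" using vector_bundleD[OF assms(1)] assms(2,3) by blast
  have "\<Phi> x (0 \<odot>\<^bsub>fibre E x\<^esub> \<zero>\<^bsub>fibre E x\<^esub>) =
      0 \<odot>\<^bsub>coord_space (vrank E)\<^esub> \<Phi> x \<zero>\<^bsub>fibre E x\<^esub>"
    by (rule linear_on_smult[OF vector_bundleD(5)[OF assms]]) simp
  then show ?thesis by (simp add: coord_space_def)
qed

lemma section_in_iff:
  "s \<in> carrier (sections M E) \<longleftrightarrow> s \<in> (\<Pi>\<^sub>E x\<in>points M. carrier (fibre E x)) \<and>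
     (\<forall>U \<Phi>. (U, \<Phi>) \<in> trivs E \<longrightarrow> (\<forall>i<vrank E. smooth_fun_on M U (\<lambda>x. \<Phi> x (s x) i)))"
  unfolding sections_def by auto

lemma section_value_in: "s \<in> carrier (sections M E) \<Longrightarrow> x \<in> points M \<Longrightarrow> s x \<in> carrier (fibre E x)"
  unfolding section_in_iff by blast

lemma section_extensional: "s \<in> carrier (sections M E) \<Longrightarrow> s \<in> extensional (points M)"
  by (simp add: section_in_iff PiE_iff)

lemma section_smooth:
  "s \<in> carrier (sections M E) \<Longrightarrow> (U, \<Phi>) \<in> trivs E \<Longrightarrow> i < vrank E \<Longrightarrow>
    smooth_fun_on M U (\<lambda>x. \<Phi> x (s x) i)"
  unfolding section_in_iff by blast

lemma restrict_sectionI: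
  assumes E: "vector_bundle M E"
    and "\<And>x. x \<in> points M \<Longrightarrow> s x \<in> carrier (fibre E x)"
    and sm: "\<And>U \<Phi> i. (U, \<Phi>) \<in> trivs E \<Longrightarrow> i < vrank E \<Longrightarrow> smooth_fun_on M U (\<lambda>x. \<Phi> x (s x) i)"
  shows "restrict s (points M) \<in> carrier (sections M E)"
  unfolding section_in_iff
proof (intro conjI allI impI)
  show "restrict s (points M) \<in> (\<Pi>\<^sub>E x\<in>points M. carrier (fibre E x))"
    using assms(2) by auto
  fix U \<Phi> i assume *: "(U, \<Phi>) \<in> trivs E" "i < vrank E"
  show "smooth_fun_on M U (\<lambda>x. \<Phi> x (restrict s (points M) x) i)"
    by (rule smooth_fun_on_cong[OF vector_bundleD(1)[OF E] vector_bundleD(3)[OF E *(1)] _ sm[OF *]])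
      (simp add: vector_bundleD(4)[OF E *(1)])
qed

lemma sections_sel [simp]:
  "\<zero>\<^bsub>sections M E\<^esub> = (\<lambda>x\<in>points M. \<zero>\<^bsub>fibre E x\<^esub>)"
  "s \<oplus>\<^bsub>sections M E\<^esub> t = (\<lambda>x\<in>points M. s x \<oplus>\<^bsub>fibre E x\<^esub> t x)"
  "c \<odot>\<^bsub>sections M E\<^esub> s = (\<lambda>x\<in>points M. c \<odot>\<^bsub>fibre E x\<^esub> s x)"
  by (simp_all add: sections_def)

lemma vspace_sections:
  assumes E: "vector_bundle M E"
  shows "vspace (sections M E)"
proof -
  note D = vector_bundleD[OF E]
  note F = vspace.vspace_simps[OF D(2)]
  show ?thesis
  proof (rule vspaceI)
    show "\<zero>\<^bsub>sections M E\<^esub> \<in> carrier (sections M E)"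
      unfolding sections_sel
    proof (rule restrict_sectionI[OF E])
      fix U \<Phi> i assume *: "(U, \<Phi>) \<in> trivs E" "i < vrank E"
      show "smooth_fun_on M U (\<lambda>x. \<Phi> x \<zero>\<^bsub>fibre E x\<^esub> i)"
        by (rule smooth_fun_on_cong[OF D(1) D(3)[OF *(1)] _ smooth_fun_on_const[of M U 0]])
          (simp add: triv_zero[OF E *(1)])
    qed (simp add: F)
  next
    fix s t assume st: "s \<in> carrier (sections M E)" "t \<in> carrier (sections M E)"
    show "s \<oplus>\<^bsub>sections M E\<^esub> t \<in> carrier (sections M E)"
      unfolding sections_sel
    proof (rule restrict_sectionI[OF E])
      fix U \<Phi> i assume *: "(U, \<Phi>) \<in> trivs E" "i < vrank E"
      have eq: "\<Phi> x (s x) i + \<Phi> x (t x) i = \<Phi> x (s x \<oplus>\<^bsub>fibre E x\<^esub> t x) i" if "x \<in> U" for x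
        using linear_on_add[OF D(5)[OF *(1) that]] st[THEN section_value_in, OF D(4)[OF *(1) that]]
        by (simp add: coord_space_def)
      show "smooth_fun_on M U (\<lambda>x. \<Phi> x (s x \<oplus>\<^bsub>fibre E x\<^esub> t x) i)"
        by (rule smooth_fun_on_cong[OF D(1) D(3)[OF *(1)] eq])
          (assumption, rule smooth_fun_on_add[OF st[THEN section_smooth, OF *]])
    qed (use st in \<open>simp add: section_value_in F\<close>)
  next
    fix c s assume s: "s \<in> carrier (sections M E)"
    show "c \<odot>\<^bsub>sections M E\<^esub> s \<in> carrier (sections M E)"
      unfolding sections_sel
    proof (rule restrict_sectionI[OF E])
      fix U \<Phi> i assume *: "(U, \<Phi>) \<in> trivs E" "i < vrank E"
      have eq: "c * \<Phi> x (s x) i = \<Phi> x (c \<odot>\<^bsub>fibre E x\<^esub> s x) i" if "x \<in> U" for x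
        using linear_on_smult[OF D(5)[OF *(1) that]] section_value_in[OF s D(4)[OF *(1) that]]
        by (simp add: coord_space_def)
      show "smooth_fun_on M U (\<lambda>x. \<Phi> x (c \<odot>\<^bsub>fibre E x\<^esub> s x) i)"
        by (rule smooth_fun_on_cong[OF D(1) D(3)[OF *(1)] eq])
          (assumption, rule smooth_fun_on_mult[OF smooth_fun_on_const section_smooth[OF s *]])
    qed (use s in \<open>simp add: section_value_in F\<close>)
  qed (auto intro!: extensionalityI[of _ "points M"] 
      simp: section_value_in section_extensional F)
qed

section \<open>Sections and morphisms of complexified bundles\<close>

lemma complexification_sel [simp]:
  "fibre (complexification A) x = complexify_space (fibre A x)"
  "vrank (complexification A) = vrank A"
  by (simp_all add: complexification_def)

lemma trivs_complexification_iff: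
  "(U, \<Psi>) \<in> trivs (complexification A) \<longleftrightarrow>
    (\<exists>\<Phi>. (U, \<Phi>) \<in> trivs A \<and> \<Psi> = (\<lambda>x (a, b) i. Complex (\<Phi> x a i) (\<Phi> x b i)))"
proof
  assume "(U, \<Psi>) \<in> trivs (complexification A)"
  then show "\<exists>\<Phi>. (U, \<Phi>) \<in> trivs A \<and> \<Psi> = (\<lambda>x (a, b) i. Complex (\<Phi> x a i) (\<Phi> x b i))"
    by (auto simp: complexification_def)
next
  assume "\<exists>\<Phi>. (U, \<Phi>) \<in> trivs A \<and> \<Psi> = (\<lambda>x (a, b) i. Complex (\<Phi> x a i) (\<Phi> x b i))"
  then obtain \<Phi> where "(U, \<Phi>) \<in> trivs A" "\<Psi> = (\<lambda>x (a, b) i. Complex (\<Phi> x a i) (\<Phi> x b i))"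
    by blast
  then show "(U, \<Psi>) \<in> trivs (complexification A)"
    unfolding complexification_def by (auto intro!: rev_image_eqI[of "(U, \<Phi>)"])
qed

text \<open>These two maps identify the sections of the complexification of a bundle with the complexification
  of its space of sections.\<close>

abbreviation merge_section :: "'m mfd \<Rightarrow> ('m \<Rightarrow> 'v) \<times> ('m \<Rightarrow> 'v) \<Rightarrow> 'm \<Rightarrow> 'v \<times> 'v" where
  "merge_section M \<equiv> \<lambda>(a, b). section_pair M a b"

abbreviation split_section :: "'m mfd \<Rightarrow> ('m \<Rightarrow> 'v \<times> 'v) \<Rightarrow> ('m \<Rightarrow> 'v) \<times> ('m \<Rightarrow> 'v)" where
  "split_section M \<equiv> \<lambda>\<alpha>. (section_Re M \<alpha>, section_Im M \<alpha>)"

context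
  fixes M :: "'m mfd" and A :: "(real, 'm, 'v) vbundle"
  assumes A: "vector_bundle M A" and C: "vector_bundle M (complexification A)"
begin

lemma section_pair_in:
  assumes "a \<in> carrier (sections M A)" "b \<in> carrier (sections M A)"
  shows "section_pair M a b \<in> carrier (sections M (complexification A))"
  unfolding section_pair_def
proof (rule restrict_sectionI[OF C])
  fix U \<Psi> i assume "(U, \<Psi>) \<in> trivs (complexification A)" "i < vrank (complexification A)"
  then show "smooth_fun_on M U (\<lambda>x. \<Psi> x (a x, b x) i)"
    using assms[THEN section_smooth] by (auto simp: trivs_complexification_iff smooth_fun_on_Complex_iff)
qed (use assms[THEN section_value_in] in simp)

lemma
  assumes \<alpha>: "\<alpha> \<in> carrier (sections M (complexification A))"
  shows section_Re_in: "section_Re M \<alpha> \<in> carrier (sections M A)"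
    and section_Im_in: "section_Im M \<alpha> \<in> carrier (sections M A)"
proof -
  have sm: "smooth_fun_on M U (\<lambda>x. \<Phi> x (fst (\<alpha> x)) i) \<and> smooth_fun_on M U (\<lambda>x. \<Phi> x (snd (\<alpha> x)) i)"
    if "(U, \<Phi>) \<in> trivs A" "i < vrank A" for U \<Phi> i
  proof -
    have "(U, \<lambda>x (a, b) i. Complex (\<Phi> x a i) (\<Phi> x b i)) \<in> trivs (complexification A)"
      using that trivs_complexification_iff by blast
    from section_smooth[OF \<alpha> this, of i] that(2) show ?thesis
      by (simp add: split_beta smooth_fun_on_Complex_iff)
  qed
  have val: "fst (\<alpha> x) \<in> carrier (fibre A x) \<and> snd (\<alpha> x) \<in> carrier (fibre A x)" if "x \<in> points M" for x
    using section_value_in[OF \<alpha> that] by (auto simp: mem_Times_iff)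
  show "section_Re M \<alpha> \<in> carrier (sections M A)" "section_Im M \<alpha> \<in> carrier (sections M A)"
    unfolding section_Re_def section_Im_def using sm val by (auto intro!: restrict_sectionI[OF A])
qed

lemma merge_split_section:
  "\<alpha> \<in> carrier (sections M (complexification A)) \<Longrightarrow> merge_section M (split_section M \<alpha>) = \<alpha>"
  by (rule extensionalityI[of _ "points M"])
    (simp_all add: section_pair_def section_Re_def section_Im_def section_extensional)

lemma linear_on_merge_section:
  "linear_on (complexify_space (sections M A)) (sections M (complexification A)) (merge_section M)"
proof -
  note F = vspace.vspace_simps[OF vector_bundleD(2)[OF A]]
  interpret S: vspace "sections M A" by (rule vspace_sections[OF A])
  show ?thesis
    unfolding linear_on_def
    by (auto simp: section_pair_in[unfolded section_pair_def] S.smult_in[unfolded sections_sel]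
        S.diff_conv_smult section_value_in section_pair_def F intro!: restrict_ext)
qed

lemma linear_on_split_section:
  "linear_on (sections M (complexification A)) (complexify_space (sections M A)) (split_section M)"
proof -
  \<comment> \<open>Linearity is inherited from \<open>merge_section M\<close>, a linear bijection with this inverse.\<close>
  have inj: "split_section M (merge_section M u) = u" if "u \<in> carrier (complexify_space (sections M A))" for u
    using that by (auto simp: section_pair_def section_Re_def section_Im_def
        intro!: extensionalityI[of _ "points M"] dest: section_extensional)
  interpret S: vspace "complexify_space (sections M A)" by (rule vspace_complexify[OF vspace_sections[OF A]])
  have sp: "split_section M \<alpha> \<in> carrier (complexify_space (sections M A))"
    if "\<alpha> \<in> carrier (sections M (complexification A))" for \<alpha>
    using that by (simp add: section_Re_in section_Im_in)
  show ?thesis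
    unfolding linear_on_def
  proof (intro conjI ballI allI)
    fix \<alpha> \<beta> assume *: "\<alpha> \<in> carrier (sections M (complexification A))" "\<beta> \<in> carrier (sections M (complexification A))"
    show "split_section M (\<alpha> \<oplus>\<^bsub>sections M (complexification A)\<^esub> \<beta>) =
        split_section M \<alpha> \<oplus>\<^bsub>complexify_space (sections M A)\<^esub> split_section M \<beta>"
      using linear_on_add[OF linear_on_merge_section sp sp, OF *] inj[OF S.a_closed[OF sp sp, OF *]]
        merge_split_section[OF *(1)] merge_split_section[OF *(2)] by metis
  next
    fix c \<alpha> assume *: "\<alpha> \<in> carrier (sections M (complexification A))"
    show "split_section M (c \<odot>\<^bsub>sections M (complexification A)\<^esub> \<alpha>) =
        c \<odot>\<^bsub>complexify_space (sections M A)\<^esub> split_section M \<alpha>"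
      using linear_on_smult[OF linear_on_merge_section sp, OF *] inj[OF S.smult_in[OF sp, OF *]]
        merge_split_section[OF *] by metis
  qed (use sp in blast)
qed

end

text \<open>A real vector has real coordinates in a complexified trivialization.  Therefore the real and
  imaginary parts of a matrix of \<open>h\<close> are matrices of the real and imaginary parts of \<open>h\<close>.\<close>

lemma
  fixes A :: "(real, 'm, 'v) vbundle" and F :: "(real, 'm, 'w) vbundle"
  assumes A: "vector_bundle M A" and F: "\<And>x. x \<in> points M \<Longrightarrow> vspace (fibre F x)"
    and h: "bundle_map M (complexification A) (complexification F) h"
  shows bundle_map_re_part: "bundle_map M A F (\<lambda>x. re_part (fibre A x) (h x))"
    and bundle_map_im_part: "bundle_map M A F (\<lambda>x. im_part (fibre A x) (h x))"
proof -
  have lin: "linear_on (complexify_space (fibre A x)) (complexify_space (fibre F x)) (h x)"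
    if "x \<in> points M" for x
    using h that unfolding bundle_map_def by simp
  have rep: "smooth_matrix_rep M A F S T (\<lambda>x. re_part (fibre A x) (h x)) \<and>
      smooth_matrix_rep M A F S T (\<lambda>x. im_part (fibre A x) (h x))"
    if S: "S \<in> trivs A" and T: "T \<in> trivs F" for S T
  proof -
    obtain U \<Phi> V \<Psi> where ST: "S = (U, \<Phi>)" "T = (V, \<Psi>)" by (metis surj_pair)
    let ?S = "(U, \<lambda>x (a, b) i. Complex (\<Phi> x a i) (\<Phi> x b i))"
    let ?T = "(V, \<lambda>x (a, b) i. Complex (\<Psi> x a i) (\<Psi> x b i))"
    have "?S \<in> trivs (complexification A)" "?T \<in> trivs (complexification F)"
      using S T ST trivs_complexification_iff by blast+
    with h have "smooth_matrix_rep M (complexification A) (complexification F) ?S ?T h"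
      unfolding bundle_map_def by blast
    then have "\<exists>G. (\<forall>i<vrank F. \<forall>j<vrank A. smooth_fun_on M (U \<inter> V) (\<lambda>x. G x i j)) \<and>
        (\<forall>x\<in>U \<inter> V. \<forall>v\<in>carrier (fibre A x) \<times> carrier (fibre A x). \<forall>i<vrank F.
          Complex (\<Psi> x (fst (h x v)) i) (\<Psi> x (snd (h x v)) i) =
          (\<Sum>j<vrank A. G x i j * Complex (\<Phi> x (fst v) j) (\<Phi> x (snd v) j)))"
      by (simp add: smooth_matrix_rep_def split_beta)
    then obtain G where G: "\<And>i j. i < vrank F \<Longrightarrow> j < vrank A \<Longrightarrow> smooth_fun_on M (U \<inter> V) (\<lambda>x. G x i j)"
      and eq: "\<forall>x\<in>U \<inter> V. \<forall>v\<in>carrier (fibre A x) \<times> carrier (fibre A x). \<forall>i<vrank F.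
          Complex (\<Psi> x (fst (h x v)) i) (\<Psi> x (snd (h x v)) i) =
          (\<Sum>j<vrank A. G x i j * Complex (\<Phi> x (fst v) j) (\<Phi> x (snd v) j))"
      by blast
    have eq': "Complex (\<Psi> x (re_part (fibre A x) (h x) a) i) (\<Psi> x (im_part (fibre A x) (h x) a) i) =
        (\<Sum>j<vrank A. G x i j * of_real (\<Phi> x a j))"
      if x: "x \<in> U \<inter> V" and a: "a \<in> carrier (fibre A x)" "i < vrank F" for x a i
    proof -
      interpret vspace "fibre A x" using vector_bundleD(2,4)[OF A] S ST x by blast
      show ?thesis
        using eq[rule_format, OF x, of "(a, \<zero>\<^bsub>fibre A x\<^esub>)" i] a triv_zero[OF A, of U \<Phi> x] S ST x
        by (simp add: re_part_def im_part_def complex_of_real_def)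
    qed
    have Re_eq: "\<Psi> x (re_part (fibre A x) (h x) a) i = (\<Sum>j<vrank A. Re (G x i j) * \<Phi> x a j)"
      and Im_eq: "\<Psi> x (im_part (fibre A x) (h x) a) i = (\<Sum>j<vrank A. Im (G x i j) * \<Phi> x a j)"
      if "x \<in> U \<inter> V" "a \<in> carrier (fibre A x)" "i < vrank F" for x a i
      using arg_cong[OF eq'[OF that], of Re] arg_cong[OF eq'[OF that], of Im] by simp_all
    have "smooth_fun_on M (U \<inter> V) (\<lambda>x. Re (G x i j))" if "i < vrank F" "j < vrank A" for i j
      by (rule smooth_fun_on_bounded_linear[OF bounded_linear_Re G[OF that]])
    then have re: "smooth_matrix_rep M A F S T (\<lambda>x. re_part (fibre A x) (h x))"
      unfolding smooth_matrix_rep_def ST prod.case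
      using Re_eq by (intro exI[of _ "\<lambda>x i j. Re (G x i j)"]) simp
    have "smooth_fun_on M (U \<inter> V) (\<lambda>x. Im (G x i j))" if "i < vrank F" "j < vrank A" for i j
      by (rule smooth_fun_on_bounded_linear[OF bounded_linear_Im G[OF that]])
    then have im: "smooth_matrix_rep M A F S T (\<lambda>x. im_part (fibre A x) (h x))"
      unfolding smooth_matrix_rep_def ST prod.case
      using Im_eq by (intro exI[of _ "\<lambda>x i j. Im (G x i j)"]) simp
    show ?thesis using re im ..
  qed
  show "bundle_map M A F (\<lambda>x. re_part (fibre A x) (h x))" "bundle_map M A F (\<lambda>x. im_part (fibre A x) (h x))"
    using rep linear_on_re_part[OF vector_bundleD(2)[OF A] F lin]
      linear_on_im_part[OF vector_bundleD(2)[OF A] F lin]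
    unfolding bundle_map_def by blast+
qed


section \<open>Decomposition of a complex Lie algebroid\<close>

lemma cderiv_of_real:
  assumes "u \<in> carrier (tangent_space M p)" "w \<in> carrier (tangent_space M p)" "f \<in> smooth_near M p"
  shows "cderiv (u, w) (\<lambda>q. of_real (f q)) = Complex (u f) (w f)"
  using assms by (simp add: cderiv_def tangent_vector_zero_fun)

lemma cyclic_sum_in:
  assumes "vspace V" and br: "skew_bilinear V br" and br': "skew_bilinear V br'"
    and abc: "a \<in> carrier V" "b \<in> carrier V" "c \<in> carrier V"
  shows "cyclic_sum V br br' a b c \<in> carrier V"
proof -
  interpret vspace V by fact
  have "br p (br' q r) \<in> carrier V" if "p \<in> carrier V" "q \<in> carrier V" "r \<in> carrier V" for p q r
    using linear_on_in[OF skew_bilinearD(1)[OF br that(1)]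
        linear_on_in[OF skew_bilinearD(1)[OF br' that(2)] that(3)]] .
  then show ?thesis using abc by (simp add: cyclic_sum_def)
qed

lemma complex_Lie_algebroidD:
  assumes "complex_Lie_algebroid M E br \<rho>"
  shows "vector_bundle M E" "skew_bilinear (sections M E) br"
    and "\<alpha> \<in> carrier (sections M E) \<Longrightarrow> \<beta> \<in> carrier (sections M E) \<Longrightarrow> \<gamma> \<in> carrier (sections M E) \<Longrightarrow>
      jacobiator (sections M E) br \<alpha> \<beta> \<gamma> = \<zero>\<^bsub>sections M E\<^esub>"
    and "bundle_map M E (complexification (tangent_bundle M)) \<rho>"
    and "\<alpha> \<in> carrier (sections M E) \<Longrightarrow> \<beta> \<in> carrier (sections M E) \<Longrightarrow> smooth_fun_on M (points M) f \<Longrightarrow>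
      br \<alpha> (fun_smult M E f \<beta>) = fun_smult M E f (br \<alpha> \<beta>)
        \<oplus>\<^bsub>sections M E\<^esub> fun_smult M E (\<lambda>x. cderiv (\<rho> x (\<alpha> x)) f) \<beta>"
  using assms unfolding complex_Lie_algebroid_def by blast+

text \<open>For a real function \<open>f\<close> and real sections, the complex derivative along \<open>\<rho> \<alpha>\<close> is
  \<open>\<rho>\<^sub>1(\<alpha>) f + \<i> \<rho>\<^sub>2(\<alpha>) f\<close>, and multiplication by \<open>f\<close> acts separately on the two components.  So the complex
  Leibniz identity is a pair of real ones.\<close>

lemma
  fixes M :: "'m mfd" and A :: "(real, 'm, 'v) vbundle"
  assumes A: "vector_bundle M A" and L: "complex_Lie_algebroid M (complexification A) br \<rho>"
  defines "B \<equiv> \<lambda>u v. split_section M (br (merge_section M u) (merge_section M v))"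
  shows skew_algebroid_re_part: "skew_algebroid M A (re_bracket (sections M A) B) (\<lambda>x. re_part (fibre A x) (\<rho> x))"
    and skew_algebroid_im_part: "skew_algebroid M A (im_bracket (sections M A) B) (\<lambda>x. im_part (fibre A x) (\<rho> x))"
proof -
  let ?V = "sections M A" and ?W = "sections M (complexification A)"
  let ?P = "\<lambda>a. section_pair M a \<zero>\<^bsub>sections M A\<^esub>"
  let ?\<rho>1 = "\<lambda>x. re_part (fibre A x) (\<rho> x)" and ?\<rho>2 = "\<lambda>x. im_part (fibre A x) (\<rho> x)"
  note LD = complex_Lie_algebroidD[OF L]
  note C = LD(1)
  have V: "vspace ?V" and W: "vspace ?W"
    using A C by (simp_all add: vspace_sections)
  interpret V: vspace ?V by fact
  have B: "skew_bilinear (complexify_space ?V) B"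
    unfolding B_def
    by (rule skew_bilinear_transport[OF vspace_complexify[OF V] W linear_on_merge_section[OF A C]
          linear_on_split_section[OF A C] LD(2)])
  have T: "vspace (fibre (tangent_bundle M) x)" for x
    by (simp add: tangent_bundle_def vspace_tangent_space)
  note F = vspace.vspace_simps[OF vector_bundleD(2)[OF A]]
  have P: "?P a \<in> carrier ?W" if "a \<in> carrier ?V" for a
    by (rule section_pair_in[OF A C that V.M.zero_closed])
  have br: "br (?P a) (?P b) x = (re_bracket ?V B a b x, im_bracket ?V B a b x)"
    if "x \<in> points M" for a b x
    using that by (simp add: re_part_def im_part_def B_def section_Re_def section_Im_def)
  have \<rho>_in: "?\<rho>1 x a \<in> carrier (tangent_space M x)" "?\<rho>2 x a \<in> carrier (tangent_space M x)"
    if x: "x \<in> points M" and a: "a \<in> carrier (fibre A x)" for x a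
  proof -
    have "linear_on (complexify_space (fibre A x)) (complexify_space (tangent_space M x)) (\<rho> x)"
      using LD(4) x unfolding bundle_map_def by (simp add: tangent_bundle_def)
    note lin = vector_bundleD(2)[OF A x] vspace_tangent_space this
    show "?\<rho>1 x a \<in> carrier (tangent_space M x)" "?\<rho>2 x a \<in> carrier (tangent_space M x)"
      using linear_on_in[OF linear_on_re_part[OF lin] a] linear_on_in[OF linear_on_im_part[OF lin] a] .
  qed
  have leibniz: "re_bracket ?V B \<alpha> (fun_smult M A f \<beta>) =
        fun_smult M A f (re_bracket ?V B \<alpha> \<beta>) \<oplus>\<^bsub>?V\<^esub> fun_smult M A (\<lambda>x. ?\<rho>1 x (\<alpha> x) f) \<beta>"
      "im_bracket ?V B \<alpha> (fun_smult M A f \<beta>) =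
        fun_smult M A f (im_bracket ?V B \<alpha> \<beta>) \<oplus>\<^bsub>?V\<^esub> fun_smult M A (\<lambda>x. ?\<rho>2 x (\<alpha> x) f) \<beta>"
    if \<alpha>: "\<alpha> \<in> carrier ?V" and \<beta>: "\<beta> \<in> carrier ?V" and f: "smooth_fun_on M (points M) f" for \<alpha> \<beta> f
  proof -
    let ?f = "\<lambda>x. of_real (f x) :: complex"
    have cf: "smooth_fun_on M (points M) ?f"
      by (rule smooth_fun_on_bounded_linear[OF bounded_linear_of_real f])
    have near: "f \<in> smooth_near M x" if "x \<in> points M" for x
      using that f by (intro smooth_nearI[of M "points M"]) simp_all
    have "?P (fun_smult M A f \<beta>) = fun_smult M (complexification A) ?f (?P \<beta>)"
      using section_value_in[OF \<beta>]
      by (auto simp: section_pair_def fun_smult_def F intro!: restrict_ext)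
    then have eq: "br (?P \<alpha>) (?P (fun_smult M A f \<beta>)) =
        fun_smult M (complexification A) ?f (br (?P \<alpha>) (?P \<beta>)) \<oplus>\<^bsub>?W\<^esub>
        fun_smult M (complexification A) (\<lambda>x. cderiv (\<rho> x (?P \<alpha> x)) ?f) (?P \<beta>)"
      using LD(5)[OF P[OF \<alpha>] P[OF \<beta>] cf] by simp
    \<comment> \<open>Both real Leibniz identities at a point are one equation between pairs, read off from
      the complex identity \<open>eq\<close>.\<close>
    have "(re_bracket ?V B \<alpha> (fun_smult M A f \<beta>) x, im_bracket ?V B \<alpha> (fun_smult M A f \<beta>) x) =
        ((fun_smult M A f (re_bracket ?V B \<alpha> \<beta>) \<oplus>\<^bsub>?V\<^esub> fun_smult M A (\<lambda>x. ?\<rho>1 x (\<alpha> x) f) \<beta>) x,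
         (fun_smult M A f (im_bracket ?V B \<alpha> \<beta>) \<oplus>\<^bsub>?V\<^esub> fun_smult M A (\<lambda>x. ?\<rho>2 x (\<alpha> x) f) \<beta>) x)"
      if x: "x \<in> points M" for x
    proof -
      have "\<rho> x (?P \<alpha> x) = (?\<rho>1 x (\<alpha> x), ?\<rho>2 x (\<alpha> x))"
        using x by (simp add: section_pair_def re_part_def im_part_def)
      then have "cderiv (\<rho> x (?P \<alpha> x)) ?f = Complex (?\<rho>1 x (\<alpha> x) f) (?\<rho>2 x (\<alpha> x) f)"
        using cderiv_of_real[OF \<rho>_in[OF x section_value_in[OF \<alpha> x]] near[OF x]] by simp
      moreover have "?P \<beta> x = (\<beta> x, \<zero>\<^bsub>fibre A x\<^esub>)"
        using x by (simp add: section_pair_def)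
      moreover have "re_bracket ?V B \<alpha> \<beta> x \<in> carrier (fibre A x)" "im_bracket ?V B \<alpha> \<beta> x \<in> carrier (fibre A x)"
        using section_value_in[OF re_bracket_in[OF V B \<alpha> \<beta>] x] section_value_in[OF im_bracket_in[OF V B \<alpha> \<beta>] x] .
      ultimately show ?thesis
        unfolding br[OF x, symmetric] eq using x section_value_in[OF \<beta> x]
        by (simp add: br[OF x] fun_smult_def F del: sections_sel(1))
    qed
    moreover have "re_bracket ?V B a b \<in> extensional (points M)" "im_bracket ?V B a b \<in> extensional (points M)" for a b
      by (simp_all add: re_part_def im_part_def B_def section_Re_def section_Im_def)
    ultimately show "re_bracket ?V B \<alpha> (fun_smult M A f \<beta>) =
        fun_smult M A f (re_bracket ?V B \<alpha> \<beta>) \<oplus>\<^bsub>?V\<^esub> fun_smult M A (\<lambda>x. ?\<rho>1 x (\<alpha> x) f) \<beta>"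
      "im_bracket ?V B \<alpha> (fun_smult M A f \<beta>) =
        fun_smult M A f (im_bracket ?V B \<alpha> \<beta>) \<oplus>\<^bsub>?V\<^esub> fun_smult M A (\<lambda>x. ?\<rho>2 x (\<alpha> x) f) \<beta>"
      by (auto intro!: extensionalityI[of _ "points M"])
  qed
  show "skew_algebroid M A (re_bracket ?V B) ?\<rho>1" "skew_algebroid M A (im_bracket ?V B) ?\<rho>2"
    unfolding skew_algebroid_def
    using A skew_bilinear_re_bracket[OF V B] skew_bilinear_im_bracket[OF V B]
      bundle_map_re_part[OF A T LD(4)] bundle_map_im_part[OF A T LD(4)] leibniz by blast+
qed

theorem theorem5p6:
  fixes M :: "'m mfd" and A :: "(real, 'm, 'v) vbundle"
    and br :: "('m \<Rightarrow> 'v \<times> 'v) \<Rightarrow> ('m \<Rightarrow> 'v \<times> 'v) \<Rightarrow> ('m \<Rightarrow> 'v \<times> 'v)"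
    and \<rho> :: "'m \<Rightarrow> 'v \<times> 'v \<Rightarrow> (('m \<Rightarrow> real) \<Rightarrow> real) \<times> (('m \<Rightarrow> real) \<Rightarrow> real)"
  assumes "smooth_manifold M"
    and "vector_bundle M A"
    and "complex_Lie_algebroid M (complexification A) br \<rho>"
  shows "\<exists>br1 \<rho>1 br2 \<rho>2.
           complex_matched_pair M A br1 \<rho>1 br2 \<rho>2 \<and>
           is_complex_sum M A br1 \<rho>1 br2 \<rho>2 br \<rho>"
proof -
  note A = assms(2) and L = complex_Lie_algebroidD[OF assms(3)]
  note C = L(1)
  define V where "V = sections M A"
  define W where "W = sections M (complexification A)"
  let ?P = "merge_section M" and ?Q = "split_section M"
  \<comment> \<open>The given bracket, as a bracket on \<open>complexify_space V\<close>.\<close>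
  define B where "B = (\<lambda>u v. ?Q (br (?P u) (?P v)))"
  let ?br1 = "re_bracket V B" and ?\<rho>1 = "\<lambda>x. re_part (fibre A x) (\<rho> x)"
  let ?br2 = "im_bracket V B" and ?\<rho>2 = "\<lambda>x. im_part (fibre A x) (\<rho> x)"
  have V: "vspace V" and W: "vspace W"
    using A C by (simp_all add: V_def W_def vspace_sections)
  note CV = vspace_complexify[OF V]
  interpret V: vspace V by fact
  have P: "linear_on (complexify_space V) W ?P" and Q: "linear_on W (complexify_space V) ?Q"
    unfolding V_def W_def using A C by (rule linear_on_merge_section linear_on_split_section)+
  have PQ: "?P (?Q \<alpha>) = \<alpha>" if "\<alpha> \<in> carrier W" for \<alpha>
    using merge_split_section[OF A C] that unfolding W_def .
  have br: "skew_bilinear W br" using L(2) unfolding W_def .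
  have B: "skew_bilinear (complexify_space V) B"
    unfolding B_def by (rule skew_bilinear_transport[OF CV W P Q br])
  have jacobi: "jacobiator (complexify_space V) B (a, \<zero>\<^bsub>V\<^esub>) (b, \<zero>\<^bsub>V\<^esub>) (c, \<zero>\<^bsub>V\<^esub>) = (\<zero>\<^bsub>V\<^esub>, \<zero>\<^bsub>V\<^esub>)"
    if "a \<in> carrier V" "b \<in> carrier V" "c \<in> carrier V" for a b c
  proof -
    have real: "(x, \<zero>\<^bsub>V\<^esub>) \<in> carrier (complexify_space V)" if "x \<in> carrier V" for x
      using that by simp
    have "jacobiator (complexify_space V) B (a, \<zero>\<^bsub>V\<^esub>) (b, \<zero>\<^bsub>V\<^esub>) (c, \<zero>\<^bsub>V\<^esub>) =
        ?Q (jacobiator W br (?P (a, \<zero>\<^bsub>V\<^esub>)) (?P (b, \<zero>\<^bsub>V\<^esub>)) (?P (c, \<zero>\<^bsub>V\<^esub>)))"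
      unfolding B_def by (rule jacobiator_transport[OF CV W P Q br PQ that[THEN real]])
    also have "\<dots> = ?Q \<zero>\<^bsub>W\<^esub>"
      by (simp only: L(3)[folded W_def, OF that[THEN real, THEN linear_on_in[OF P]]])
    also have "\<dots> = (\<zero>\<^bsub>V\<^esub>, \<zero>\<^bsub>V\<^esub>)"
      using linear_on_zero[OF W CV Q] by simp
    finally show ?thesis .
  qed
  have "complex_matched_pair M A ?br1 ?\<rho>1 ?br2 ?\<rho>2"
    unfolding complex_matched_pair_def
  proof (intro conjI ballI)
    show "skew_algebroid M A ?br1 ?\<rho>1" "skew_algebroid M A ?br2 ?\<rho>2"
      using skew_algebroid_re_part[OF A assms(3)] skew_algebroid_im_part[OF A assms(3)]
      unfolding V_def B_def by blast+
  next
    fix a b c assume "a \<in> carrier (sections M A)" "b \<in> carrier (sections M A)" "c \<in> carrier (sections M A)"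
    then have abc: "a \<in> carrier V" "b \<in> carrier V" "c \<in> carrier V" by (simp_all add: V_def)
    have eqs: "jacobiator V ?br1 a b c \<ominus>\<^bsub>V\<^esub> jacobiator V ?br2 a b c = \<zero>\<^bsub>V\<^esub>"
      "cyclic_sum V ?br2 ?br1 a b c \<oplus>\<^bsub>V\<^esub> cyclic_sum V ?br1 ?br2 a b c = \<zero>\<^bsub>V\<^esub>"
      using jacobi[OF abc] by (simp_all add: jacobiator_real_vectors[OF V B abc])
    note skew = skew_bilinear_re_bracket[OF V B] skew_bilinear_im_bracket[OF V B]
    show "cyclic_sum (sections M A) ?br2 ?br1 a b c \<oplus>\<^bsub>sections M A\<^esub>
        cyclic_sum (sections M A) ?br1 ?br2 a b c = \<zero>\<^bsub>sections M A\<^esub>"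
      using eqs(2) unfolding V_def .
    show "jacobiator (sections M A) ?br1 a b c = jacobiator (sections M A) ?br2 a b c"
      using V.diff_eq_zeroD[OF eqs(1) cyclic_sum_in[OF V skew(1,1) abc] cyclic_sum_in[OF V skew(2,2) abc]]
      unfolding V_def .
  qed
  moreover have "is_complex_sum M A ?br1 ?\<rho>1 ?br2 ?\<rho>2 br \<rho>"
    unfolding is_complex_sum_def
  proof (intro conjI ballI)
    fix \<alpha> \<beta> assume "\<alpha> \<in> carrier (sections M (complexification A))" "\<beta> \<in> carrier (sections M (complexification A))"
    then have \<alpha>: "\<alpha> \<in> carrier W" and \<beta>: "\<beta> \<in> carrier W" by (simp_all add: W_def)
    let ?a = "section_Re M \<alpha>" and ?b = "section_Im M \<alpha>" and ?c = "section_Re M \<beta>" and ?d = "section_Im M \<beta>"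
    let ?br = "\<lambda>a b. (?br1 a b, ?br2 a b)"
    have parts: "?a \<in> carrier V" "?b \<in> carrier V" "?c \<in> carrier V" "?d \<in> carrier V"
      using linear_on_in[OF Q \<alpha>] linear_on_in[OF Q \<beta>] by simp_all
    interpret CV: vspace "complexify_space V" by fact
    have in_CV: "?br p q \<in> carrier (complexify_space V)" if "p \<in> carrier V" "q \<in> carrier V" for p q
      using that by (simp add: re_bracket_in im_bracket_in V B)
    have "br \<alpha> \<beta> \<in> carrier W"
      by (rule linear_on_in[OF skew_bilinearD(1)[OF br \<alpha>] \<beta>])
    then have "br \<alpha> \<beta> = ?P (B (?a, ?b) (?c, ?d))"
      using PQ PQ[OF \<alpha>] PQ[OF \<beta>] by (simp add: B_def)
    also have "\<dots> = ?P ((?br ?a ?c \<ominus>\<^bsub>complexify_space V\<^esub> ?br ?b ?d) \<oplus>\<^bsub>complexify_space V\<^esub>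
        \<i> \<odot>\<^bsub>complexify_space V\<^esub> (?br ?a ?d \<oplus>\<^bsub>complexify_space V\<^esub> ?br ?b ?c))"
      by (simp only: bracket_eq_complex_sum[OF V B parts])
    also have "\<dots> = (?P (?br ?a ?c) \<ominus>\<^bsub>W\<^esub> ?P (?br ?b ?d)) \<oplus>\<^bsub>W\<^esub>
        \<i> \<odot>\<^bsub>W\<^esub> (?P (?br ?a ?d) \<oplus>\<^bsub>W\<^esub> ?P (?br ?b ?c))"
      by (simp only: in_CV parts CV.a_closed CV.minus_closed CV.smult_in
          linear_on_add[OF P] linear_on_smult[OF P] linear_on_diff[OF CV W P])
    also have "\<dots> = complex_sum_bracket M A ?br1 ?br2 \<alpha> \<beta>"
      by (simp add: complex_sum_bracket_def Let_def W_def del: sections_sel)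
    finally show "br \<alpha> \<beta> = complex_sum_bracket M A ?br1 ?br2 \<alpha> \<beta>" .
  next
    fix x v assume x: "x \<in> points M" and v: "v \<in> carrier (fibre (complexification A) x)"
    then obtain a b where ab: "v = (a, b)" "a \<in> carrier (fibre A x)" "b \<in> carrier (fibre A x)" by auto
    have "linear_on (complexify_space (fibre A x)) (complexify_space (tangent_space M x)) (\<rho> x)"
      using L(4) x unfolding bundle_map_def by (simp add: tangent_bundle_def)
    from linear_on_complexify_eq[OF vector_bundleD(2)[OF A x] vspace_tangent_space this ab(2,3)]
    show "\<rho> x v = complex_sum_anchor M ?\<rho>1 ?\<rho>2 x v"
      by (simp add: complex_sum_anchor_def ab(1))
  qed
  ultimately show ?thesis by blast
qed

end
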